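(* Assume $f_1,f_2\in C^1(\mathbb R)$, $f_i(0)=0$, and that for $i=1,2$ there is $K_i>0$ with $f_i\le 0$ on $[K_i,+\infty)$. Let $\lambda_1$ be the principal eigenvalue and (E) the stationary problem defined in the context. (i) If $\lambda_1<0$, then there exists a bounded, positive and periodic solution $p$ of (E). (ii) If $\lambda_1\ge0$ and if, in addition, the functions $s\mapsto f_i(s)/s$ are non-increasing in $s>0$ for $i=1,2$ and decreasing in $s>0$ for at least one $i\in\{1,2\}$, then $0$ is the only nonnegative bounded solution of (E).
   Context: Setting. Fix constants $l_1,l_2,d_1,d_2,\sigma>0$ and put $l=l_1+l_2$. For $n\in\mathbb Z$, the open intervals $(nl-l_1,nl)$ are the patches of type 1 and the open intervals $(nl,nl+l_2)$ are the patches of type 2; a "patch" is any of these intervals. Put $S_1=l\mathbb Z$, $S_2=l_2+l\mathbb Z$ and $S=S_1\cup S_2$. For $x$ in a patch of type $i$ set $d(x)=d_i$, $f(x,s)=f_i(s)$ and $f_s(x,0)=f_i'(0)$. "Periodic" means $l$-periodic in $x$. Stationary problem (E): a solution is a continuous function $p:\mathbb R\to\mathbb R$ with $p|_{\bar I}\in C^2(\bar I)$ for each patch $I$, such that $-d(x)p''(x)-f(x,p(x))=0$ for $x\in\mathbb R\setminus S$; $p(x^-)=p(x^+)$, $p'(x^-)=\sigma p'(x^+)$ for $x\in S_1$; $p(x^-)=p(x^+)$, $\sigma p'(x^-)=p'(x^+)$ for $x\in S_2$. Principal eigenvalue $\lambda_1$: the unique real number for which there is a (unique) continuous function $\phi:\mathbb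 R\to\mathbb R$ with $\phi|_{\bar I}\in C^\infty(\bar I)$ for each patch $I$, such that $-d(x)\phi''-f_s(x,0)\phi=\lambda_1\phi$ in $\mathbb R\setminus S$, $\phi'(x^-)=\sigma\phi'(x^+)$ for $x\in S_1$, $\sigma\phi'(x^-)=\phi'(x^+)$ for $x\in S_2$, $\phi$ is periodic, $\phi>0$ and $\|\phi\|_{L^\infty(\mathbb R)}=1$. *)

theory Defs
  imports "HOL-Analysis.Analysis" "HOL-Probability.Essential_Supremum"
begin

section \<open>The periodic patch structure\<close>

definition patches1 :: "real \<Rightarrow> real \<Rightarrow> real set set" where
  "patches1 l1 l2 = range (\<lambda>n::int. {of_int n * (l1 + l2) - l1 <..< of_int n * (l1 + l2)})"

definition patches2 :: "real \<Rightarrow> real \<Rightarrow> real set set" where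
  "patches2 l1 l2 = range (\<lambda>n::int. {of_int n * (l1 + l2) <..< of_int n * (l1 + l2) + l2})"

definition patches :: "real \<Rightarrow> real \<Rightarrow> real set set" where
  "patches l1 l2 = patches1 l1 l2 \<union> patches2 l1 l2"

definition S1 :: "real \<Rightarrow> real \<Rightarrow> real set" where
  "S1 l1 l2 = range (\<lambda>n::int. of_int n * (l1 + l2))"

definition S2 :: "real \<Rightarrow> real \<Rightarrow> real set" where
  "S2 l1 l2 = range (\<lambda>n::int. l2 + of_int n * (l1 + l2))"

definition interfaces :: "real \<Rightarrow> real \<Rightarrow> real set" where
  "interfaces l1 l2 = S1 l1 l2 \<union> S2 l1 l2"

text \<open>\<open>patchwise l1 l2 a1 a2 x\<close> is \<open>ai\<close> for \<open>x\<close> in a patch of type \<open>i\<close>; its values on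
  \<open>interfaces l1 l2\<close> carry no meaning and are never used.  Thus \<open>d(x)\<close> is
  \<open>patchwise l1 l2 d1 d2 x\<close> and \<open>f(x, s)\<close> is \<open>patchwise l1 l2 f1 f2 x s\<close>.\<close>

definition patchwise :: "real \<Rightarrow> real \<Rightarrow> 'a \<Rightarrow> 'a \<Rightarrow> real \<Rightarrow> 'a" where
  "patchwise l1 l2 a1 a2 x = (if x \<in> \<Union> (patches1 l1 l2) then a1 else a2)"

definition periodic :: "real \<Rightarrow> (real \<Rightarrow> real) \<Rightarrow> bool" where
  "periodic l p \<longleftrightarrow> (\<forall>x. p (x + l) = p x)"


section \<open>Regularity up to the boundary and one-sided limits\<close>

text \<open>Derivatives are taken within \<open>A\<close>, so \<open>Ck_on k p A\<close> depends only on the restriction of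
  \<open>p\<close> to \<open>A\<close>, and for a compact interval the derivatives at the end points are one-sided.\<close>

definition Ck_on :: "nat \<Rightarrow> (real \<Rightarrow> real) \<Rightarrow> real set \<Rightarrow> bool" where
  "Ck_on k p A \<longleftrightarrow> (\<exists>D :: nat \<Rightarrow> real \<Rightarrow> real. D 0 = p \<and>
     (\<forall>j<k. \<forall>x\<in>A. (D j has_real_derivative D (Suc j) x) (at x within A)) \<and>
     continuous_on A (D k))"

definition Cinf_on :: "(real \<Rightarrow> real) \<Rightarrow> real set \<Rightarrow> bool" where
  "Cinf_on p A \<longleftrightarrow> (\<forall>k. Ck_on k p A)"

text \<open>\<open>p(x\<^sup>-)\<close> and \<open>p(x\<^sup>+)\<close>.  Below they are applied to \<open>p\<close> and \<open>deriv p\<close> for functions \<open>p\<close>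
  that are at least twice continuously differentiable on the closure of each patch, for which
  these limits exist.\<close>

definition left_lim :: "(real \<Rightarrow> real) \<Rightarrow> real \<Rightarrow> real" where
  "left_lim p x = Lim (at_left x) p"

definition right_lim :: "(real \<Rightarrow> real) \<Rightarrow> real \<Rightarrow> real" where
  "right_lim p x = Lim (at_right x) p"


section \<open>The stationary problem and the principal eigenvalue\<close>

definition stationary_solution ::
  "real \<Rightarrow> real \<Rightarrow> real \<Rightarrow> real \<Rightarrow> real \<Rightarrow> (real \<Rightarrow> real) \<Rightarrow> (real \<Rightarrow> real) \<Rightarrow> (real \<Rightarrow> real) \<Rightarrow> bool"
  where
  "stationary_solution l1 l2 d1 d2 \<sigma> f1 f2 p \<longleftrightarrow>
     continuous_on UNIV p \<and>
     (\<forall>I\<in>patches l1 l2. Ck_on 2 p (closure I)) \<and>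
     (\<forall>x. x \<notin> interfaces l1 l2 \<longrightarrow>
        - patchwise l1 l2 d1 d2 x * deriv (deriv p) x - patchwise l1 l2 f1 f2 x (p x) = 0) \<and>
     (\<forall>x\<in>S1 l1 l2. left_lim p x = right_lim p x \<and>
        left_lim (deriv p) x = \<sigma> * right_lim (deriv p) x) \<and>
     (\<forall>x\<in>S2 l1 l2. left_lim p x = right_lim p x \<and>
        \<sigma> * left_lim (deriv p) x = right_lim (deriv p) x)"

definition principal_eigenfunction ::
  "real \<Rightarrow> real \<Rightarrow> real \<Rightarrow> real \<Rightarrow> real \<Rightarrow> (real \<Rightarrow> real) \<Rightarrow> (real \<Rightarrow> real) \<Rightarrow> real \<Rightarrow> (real \<Rightarrow> real) \<Rightarrow> bool"
  where
  "principal_eigenfunction l1 l2 d1 d2 \<sigma> f1 f2 \<mu> \<phi> \<longleftrightarrow>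
     continuous_on UNIV \<phi> \<and>
     (\<forall>I\<in>patches l1 l2. Cinf_on \<phi> (closure I)) \<and>
     (\<forall>x. x \<notin> interfaces l1 l2 \<longrightarrow>
        - patchwise l1 l2 d1 d2 x * deriv (deriv \<phi>) x
          - deriv (patchwise l1 l2 f1 f2 x) 0 * \<phi> x = \<mu> * \<phi> x) \<and>
     (\<forall>x\<in>S1 l1 l2. left_lim (deriv \<phi>) x = \<sigma> * right_lim (deriv \<phi>) x) \<and>
     (\<forall>x\<in>S2 l1 l2. \<sigma> * left_lim (deriv \<phi>) x = right_lim (deriv \<phi>) x) \<and>
     periodic (l1 + l2) \<phi> \<and>
     (\<forall>x. \<phi> x > 0) \<and>
     esssup lborel (\<lambda>x. ereal \<bar>\<phi> x\<bar>) = 1"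

text \<open>Exactly one real number has a principal eigenfunction, and that eigenfunction is unique.
  The predicate below does not itself demand uniqueness, so that assuming it never
  presupposes more than the existence of an eigenfunction.\<close>

definition principal_eigenvalue ::
  "real \<Rightarrow> real \<Rightarrow> real \<Rightarrow> real \<Rightarrow> real \<Rightarrow> (real \<Rightarrow> real) \<Rightarrow> (real \<Rightarrow> real) \<Rightarrow> real \<Rightarrow> bool"
  where
  "principal_eigenvalue l1 l2 d1 d2 \<sigma> f1 f2 \<mu> \<longleftrightarrow>
     (\<exists>\<phi>. principal_eigenfunction l1 l2 d1 d2 \<sigma> f1 f2 \<mu> \<phi>)"

end

theory Submission
  imports Defs
begin

text \<open>
  The jump conditions at the interfaces say that the flux, equal to \<open>p'\<close> in patches of type 1 and to
  \<open>\<sigma> * p'\<close> in patches of type 2, is continuous (\<open>flux_exists\<close>). In one space dimension everything then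
  follows from the Wronskian of a solution \<open>p\<close> and the principal eigenfunction \<open>\<phi>\<close>, formed with the
  fluxes. It is continuous, and its derivative is a positive factor times
  \<open>(f'(0) + \<lambda>) * p - f(p)\<close>, where \<open>\<lambda>\<close> is the principal eigenvalue.

  If \<open>\<lambda> \<ge> 0\<close> and \<open>f(s) / s\<close> is nonincreasing, this factor is nonnegative for every \<open>p \<ge> 0\<close>. So the
  Wronskian is monotone on \<open>\<real>\<close>, and it is a positive multiple of the derivative of \<open>p / \<phi>\<close> off the
  interfaces. If it did not vanish identically, the bounded function \<open>p / \<phi>\<close> would grow linearly in one
  direction. Hence \<open>p\<close> is a multiple of \<open>\<phi>\<close>, and strict monotonicity of one of the quotients forces the
  multiple to be zero (\<open>bounded_solution_vanishes\<close>).

  If \<open>\<lambda> < 0\<close>, a positive periodic solution that is symmetric about the centre of every patch is found by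
  shooting (\<open>even_profiles_exist\<close>, \<open>periodic_solution_exists\<close>): start at the centre of a patch of type 1
  with height \<open>a\<close> and slope \<open>0\<close>, and choose \<open>a\<close> such that the slope at the centre of the next patch
  vanishes. That slope is nonnegative for a height \<open>a\<close> beyond which both nonlinearities are nonpositive,
  and negative for small \<open>a\<close> because of the Wronskian with the symmetrised eigenfunction. The solution
  stays between \<open>0\<close> and the large height, since beyond these levels it would be trapped
  (\<open>reach_zero\<close>, \<open>overshoot_above\<close>) and arrive with a nonzero slope. Reflections at the centres
  extend it to a periodic function (\<open>glue_stationary\<close>).
\<close>

section \<open>Ordinary differential equations with a Lipschitz right-hand side\<close>

lemma antiderivative_from_0:
  fixes g :: "real \<Rightarrow> 'a::euclidean_space"
  assumes "continuous_on UNIV g"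
  obtains G where "G 0 = 0" "\<And>t. (G has_vector_derivative g t) (at t)"
proof -
  have "\<exists>F. \<forall>x. (-\<infinity>::ereal) < ereal x \<longrightarrow> ereal x < \<infinity> \<longrightarrow> (F has_vector_derivative g x) (at x)"
    using assms by (intro einterval_antiderivative) (auto simp: continuous_on_eq_continuous_at)
  then obtain F where F: "\<And>t. (F has_vector_derivative g t) (at t)"
    by auto
  show thesis
  proof (rule that[of "\<lambda>t. F t - F 0"])
    show "((\<lambda>t. F t - F 0) has_vector_derivative g t) (at t)" for t
      using has_vector_derivative_diff[OF F[of t] has_vector_derivative_const[of "F 0"]] by simp
  qed simp
qed

text \<open>Integrating over the half line from \<open>0\<close> gains a factor \<open>1 / K\<close> against a weight
  \<open>exp (K * \<bar>t\<bar>)\<close>. For large \<open>K\<close> this makes the integral operator of an initial value problem a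
  contraction on all of \<open>\<real>\<close> at once.\<close>

lemma antiderivative_exp_bound:
  fixes G :: "real \<Rightarrow> 'a::real_normed_vector"
  assumes G: "\<And>t. (G has_vector_derivative g t) (at t)" and G0: "G 0 = 0" and K: "K > 0"
    and g: "\<And>t. norm (g t) \<le> C * exp (K * \<bar>t\<bar>)"
  shows "norm (G t) \<le> C / K * exp (K * \<bar>t\<bar>)"
proof -
  have C: "C \<ge> 0"
    using order_trans[OF norm_ge_zero g[of 0]] by simp
  have half_line: "norm (H s) \<le> C / K * exp (K * s)"
    if H: "\<And>t. (H has_vector_derivative h t) (at t)" and H0: "H 0 = 0"
      and h: "\<And>t. norm (h t) \<le> C * exp (K * \<bar>t\<bar>)" and s: "s > 0" for H :: "real \<Rightarrow> 'a" and h s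
  proof -
    have "norm (H s - H 0) \<le> C / K * exp (K * s) - C / K * exp (K * 0)"
    proof (rule differentiable_bound_general[OF s, where f' = h and \<phi>' = "\<lambda>t. C * exp (K * t)"])
      show "continuous_on {0..s} H"
        using H by (meson continuous_at_imp_continuous_on has_vector_derivative_continuous)
      show "((\<lambda>t. C / K * exp (K * t)) has_vector_derivative C * exp (K * t)) (at t)" for t
        using K by (auto simp flip: has_real_derivative_iff_has_vector_derivative
            intro!: derivative_eq_intros)
      show "norm (h t) \<le> C * exp (K * t)" if "0 < t" for t
        using h[of t] that by simp
    qed (use K in \<open>auto intro!: continuous_intros H\<close>)
    also have "\<dots> \<le> C / K * exp (K * s)"
      using C K by simp
    finally show ?thesis
      using H0 by simp
  qed
  consider "t > 0" | "t = 0" | "t < 0"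
    by linarith
  then show ?thesis
  proof cases
    case 1
    then show ?thesis
      using half_line[OF G G0 g 1] by simp
  next
    case 2
    then show ?thesis
      using C K G0 by simp
  next
    case 3
    have "((\<lambda>s. G (- s)) has_vector_derivative - g (- s)) (at s)" for s
      using vector_diff_chain_at[OF has_vector_derivative_minus[OF has_vector_derivative_id], OF G, of s]
      by (simp add: o_def)
    from half_line[OF this, of "- t"] g 3 G0 show ?thesis
      by (simp add: abs_minus_commute) (metis abs_minus_cancel)
  qed
qed

text \<open>Picard iteration for \<open>x = exp (K * \<bar>t\<bar>) *\<^sub>R v\<close>, where \<open>v\<close> is the fixed point in the Banach space of
  bounded continuous functions. The exponential weight replaces the usual continuation of local
  solutions: one application of the fixed point theorem gives a solution on the whole line.\<close>

lemma lipschitz_ode_exists: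
  fixes F :: "'a::euclidean_space \<Rightarrow> 'a"
  assumes F: "L-lipschitz_on UNIV F"
  obtains x where "x 0 = x0" "\<And>t::real. (x has_vector_derivative F (x t)) (at t)"
proof -
  define K where "K = 2 * L + 1"
  have L: "L \<ge> 0" and K: "K > 0" and LK: "L / K \<le> 1 / 2"
    using lipschitz_on_nonneg[OF F] by (auto simp: K_def field_simps)
  have Fdist: "norm (F y - F z) \<le> L * norm (y - z)" for y z
    using lipschitz_onD[OF F, of y z] by (simp add: dist_norm)
  have Fcont: "continuous_on UNIV F"
    using F by (rule lipschitz_on_continuous_on)
  have "\<forall>g::real \<Rightarrow> 'a. \<exists>G. continuous_on UNIV g \<longrightarrow>
      G 0 = 0 \<and> (\<forall>t. (G has_vector_derivative g t) (at t))"
    using antiderivative_from_0 by metis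
  then obtain P where P0: "\<And>g::real \<Rightarrow> 'a. continuous_on UNIV g \<Longrightarrow> P g 0 = 0"
    and P: "\<And>g t. continuous_on UNIV g \<Longrightarrow> (P g has_vector_derivative g t) (at t)"
    by metis
  define rhs where "rhs v = (\<lambda>t. F (exp (K * \<bar>t\<bar>) *\<^sub>R apply_bcontfun v t))" for v :: "real \<Rightarrow>\<^sub>C 'a"
  define T where "T v = (\<lambda>t. exp (- (K * \<bar>t\<bar>)) *\<^sub>R (x0 + P (rhs v) t))" for v
  have rhs_cont: "continuous_on UNIV (rhs v)" for v
    unfolding rhs_def by (rule continuous_on_compose2[OF Fcont]) (auto intro!: continuous_intros)
  note P0 = P0[OF rhs_cont] and P = P[OF rhs_cont]
  have T_bcontfun: "T v \<in> bcontfun" for v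
  proof (rule bcontfun_normI)
    have "continuous_on UNIV (P (rhs v))"
      using P by (meson continuous_at_imp_continuous_on has_vector_derivative_continuous)
    then show "continuous_on UNIV (T v)"
      unfolding T_def by (auto intro!: continuous_intros)
    let ?C = "norm (F 0) + L * norm v"
    have "norm (rhs v t) \<le> ?C * exp (K * \<bar>t\<bar>)" for t
    proof -
      have "norm (rhs v t) \<le> norm (F 0) + norm (rhs v t - F 0)"
        by (metis add.commute norm_triangle_sub)
      also have "norm (rhs v t - F 0) \<le> L * (exp (K * \<bar>t\<bar>) * norm (apply_bcontfun v t))"
        using Fdist[of "exp (K * \<bar>t\<bar>) *\<^sub>R apply_bcontfun v t" 0] by (simp add: rhs_def)
      also have "\<dots> \<le> L * (exp (K * \<bar>t\<bar>) * norm v)"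
        by (intro mult_left_mono norm_bounded) (use L in auto)
      also have "norm (F 0) \<le> norm (F 0) * exp (K * \<bar>t\<bar>)"
        using K by (simp add: mult_le_cancel_left1)
      finally show ?thesis
        by (simp add: algebra_simps)
    qed
    then have "norm (P (rhs v) t) \<le> ?C / K * exp (K * \<bar>t\<bar>)" for t
      by (rule antiderivative_exp_bound[OF P P0 K])
    then have *: "exp (- (K * \<bar>t\<bar>)) * norm (P (rhs v) t) \<le> ?C / K" for t
      by (simp add: exp_minus field_simps)
    show "norm (T v t) \<le> norm x0 + ?C / K" for t
    proof -
      have "norm (T v t) \<le> exp (- (K * \<bar>t\<bar>)) * (norm x0 + norm (P (rhs v) t))"
        by (simp add: T_def norm_triangle_ineq)
      also have "\<dots> \<le> 1 * norm x0 + ?C / K"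
        unfolding distrib_left by (intro add_mono mult_right_mono *) (use K in auto)
      finally show ?thesis by simp
    qed
  qed
  have contraction: "dist (Bcontfun (T v)) (Bcontfun (T w)) \<le> 1 / 2 * dist v w" for v w
  proof (rule dist_bound)
    fix t
    have "norm (rhs v t - rhs w t) \<le> (L * dist v w) * exp (K * \<bar>t\<bar>)" for t
    proof -
      have "norm (rhs v t - rhs w t) \<le> L * (exp (K * \<bar>t\<bar>) * dist (apply_bcontfun v t) (apply_bcontfun w t))"
        using Fdist[of "exp (K * \<bar>t\<bar>) *\<^sub>R apply_bcontfun v t" "exp (K * \<bar>t\<bar>) *\<^sub>R apply_bcontfun w t"]
        by (simp add: rhs_def dist_norm flip: scaleR_diff_right)
      also have "\<dots> \<le> L * (exp (K * \<bar>t\<bar>) * dist v w)"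
        by (intro mult_left_mono dist_bounded) (use L in auto)
      finally show ?thesis
        by (simp add: algebra_simps)
    qed
    then have "norm (P (rhs v) t - P (rhs w) t) \<le> (L * dist v w) / K * exp (K * \<bar>t\<bar>)"
      by (intro antiderivative_exp_bound[where G = "\<lambda>t. P (rhs v) t - P (rhs w) t"
            and g = "\<lambda>t. rhs v t - rhs w t"])
         (auto intro!: has_vector_derivative_diff P simp: P0 K)
    then have *: "exp (- (K * \<bar>t\<bar>)) * norm (P (rhs v) t - P (rhs w) t) \<le> L / K * dist v w"
      by (simp add: exp_minus field_simps)
    have "dist (T v t) (T w t) = exp (- (K * \<bar>t\<bar>)) * norm (P (rhs v) t - P (rhs w) t)"
      by (simp add: T_def dist_norm flip: scaleR_diff_right)
    also have "\<dots> \<le> 1 / 2 * dist v w"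
      using * LK by (meson mult_right_mono order_trans zero_le_dist)
    finally show "dist (apply_bcontfun (Bcontfun (T v)) t) (apply_bcontfun (Bcontfun (T w)) t) \<le> 1 / 2 * dist v w"
      by (simp add: Bcontfun_inverse[OF T_bcontfun])
  qed
  obtain v where "Bcontfun (T v) = v"
    using banach_fix_type[of "1 / 2" "\<lambda>v. Bcontfun (T v)"] contraction by auto
  then have v: "apply_bcontfun v = T v"
    by (metis Bcontfun_inverse T_bcontfun)
  have rhs_v: "rhs v t = F (x0 + P (rhs v) t)" for t
  proof -
    have "exp (K * \<bar>t\<bar>) *\<^sub>R apply_bcontfun v t = x0 + P (rhs v) t"
      by (simp add: v T_def flip: exp_add)
    then show ?thesis
      by (simp add: rhs_def)
  qed
  show thesis
  proof (rule that[of "\<lambda>t. x0 + P (rhs v) t"])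
    show "((\<lambda>t. x0 + P (rhs v) t) has_vector_derivative F (x0 + P (rhs v) t)) (at t)" for t
      unfolding rhs_v[symmetric]
      using has_vector_derivative_add[OF has_vector_derivative_const P] by simp
  qed (simp add: P0)
qed

text \<open>Gronwall's estimate in both directions: the derivative of the squared distance \<open>E\<close> lies
  between \<open>- 2 * L * E\<close> and \<open>2 * L * E\<close>. The upper bound gives uniqueness and continuous dependence
  on the initial value, the lower bound says that distinct solutions never meet.\<close>

lemma lipschitz_ode_distance:
  fixes F :: "'a::real_inner \<Rightarrow> 'a"
  assumes F: "L-lipschitz_on UNIV F"
    and x: "\<And>t. t \<in> {0..\<tau>} \<Longrightarrow> (x has_vector_derivative F (x t)) (at t within {0..\<tau>})"
    and y: "\<And>t. t \<in> {0..\<tau>} \<Longrightarrow> (y has_vector_derivative F (y t)) (at t within {0..\<tau>})"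
    and t: "t \<in> {0..\<tau>}"
  shows "norm (x t - y t) \<le> exp (L * t) * norm (x 0 - y 0)"
    and "norm (x 0 - y 0) \<le> exp (L * t) * norm (x t - y t)"
proof -
  define E where "E t = (x t - y t) \<bullet> (x t - y t)" for t
  define E' where "E' t = 2 * ((x t - y t) \<bullet> (F (x t) - F (y t)))" for t
  have dE: "(E has_real_derivative E' s) (at s within {0..\<tau>})" if "s \<in> {0..\<tau>}" for s
  proof -
    have d: "((\<lambda>t. x t - y t) has_derivative (\<lambda>h. h *\<^sub>R (F (x s) - F (y s)))) (at s within {0..\<tau>})"
      using has_vector_derivative_diff[OF x[OF that] y[OF that]]
      by (simp add: has_vector_derivative_def)
    have "(E has_derivative (\<lambda>h. (x s - y s) \<bullet> (h *\<^sub>R (F (x s) - F (y s))) +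
        (h *\<^sub>R (F (x s) - F (y s))) \<bullet> (x s - y s))) (at s within {0..\<tau>})"
      unfolding E_def by (rule has_derivative_inner[OF d d])
    also have "(\<lambda>h. (x s - y s) \<bullet> (h *\<^sub>R (F (x s) - F (y s))) +
        (h *\<^sub>R (F (x s) - F (y s))) \<bullet> (x s - y s)) = (*) (E' s)"
      by (auto simp: E'_def inner_commute)
    finally show ?thesis
      by (simp add: has_field_derivative_def)
  qed
  have bound: "\<bar>E' s\<bar> \<le> 2 * L * E s" for s
  proof -
    have "\<bar>E' s\<bar> \<le> 2 * (norm (x s - y s) * norm (F (x s) - F (y s)))"
      unfolding E'_def abs_mult using Cauchy_Schwarz_ineq2 by simp
    also have "\<dots> \<le> 2 * (norm (x s - y s) * (L * norm (x s - y s)))"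
      using lipschitz_onD[OF F, of "x s" "y s"]
      by (intro mult_left_mono) (auto simp: dist_norm)
    finally show ?thesis
      by (simp add: E_def dot_square_norm power2_eq_square mult_ac)
  qed
  have mono: "0 \<le> exp (c * t) * E t * k - E 0 * k"
    if "\<And>s. 0 \<le> k * (c * E s + E' s)" for c k
  proof -
    have "((\<lambda>s. k * (exp (c * s) * (c * E s + E' s))) has_integral
        (k * (exp (c * t) * E t) - k * (exp (c * 0) * E 0))) {0..t}"
    proof (rule fundamental_theorem_of_calculus)
      show "((\<lambda>s. k * (exp (c * s) * E s)) has_vector_derivative
          k * (exp (c * s) * (c * E s + E' s))) (at s within {0..t})" if "s \<in> {0..t}" for s
      proof -
        have "s \<in> {0..\<tau>}"
          using that t by auto
        then have "(E has_real_derivative E' s) (at s within {0..t})"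
          by (rule DERIV_subset[OF dE]) (use t in auto)
        then show ?thesis
          by (auto simp: algebra_simps simp flip: has_real_derivative_iff_has_vector_derivative
              intro!: derivative_eq_intros)
      qed
    qed (use t in auto)
    then have "0 \<le> k * (exp (c * t) * E t) - k * (exp (c * 0) * E 0)"
      by (rule has_integral_nonneg)
         (metis that exp_ge_zero mult.left_commute mult_nonneg_nonneg)
    then show ?thesis
      by (simp add: algebra_simps)
  qed
  have up: "exp (- (2 * L) * t) * E t \<le> E 0"
    using mono[where k = "-1" and c = "- (2 * L)"] bound abs_le_iff by auto
  have down: "E 0 \<le> exp (2 * L * t) * E t"
    using mono[where k = 1 and c = "2 * L"] bound
    by (auto simp: abs_le_iff) (smt (verit))
  have sq: "(exp (L * t) * norm z)\<^sup>2 = exp (2 * L * t) * (z \<bullet> z)" for z :: 'a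
    by (simp add: power_mult_distrib power2_norm_eq_inner flip: exp_double)
  have "norm (x t - y t) ^ 2 \<le> (exp (L * t) * norm (x 0 - y 0)) ^ 2"
    using up unfolding sq by (simp add: E_def power2_norm_eq_inner exp_minus field_simps)
  then show "norm (x t - y t) \<le> exp (L * t) * norm (x 0 - y 0)"
    by (rule power2_le_imp_le) simp
  have "norm (x 0 - y 0) ^ 2 \<le> (exp (L * t) * norm (x t - y t)) ^ 2"
    using down unfolding sq by (simp add: E_def power2_norm_eq_inner)
  then show "norm (x 0 - y 0) \<le> exp (L * t) * norm (x t - y t)"
    by (rule power2_le_imp_le) simp
qed

section \<open>Phase plane of a scalar equation of second order\<close>

text \<open>The equation \<open>u'' + g u = 0\<close> as a first-order system with \<open>v = u'\<close>. Derivatives are taken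
  within \<open>T\<close>, so that the same predicate serves for closed patches, with one-sided derivatives at
  the interfaces, and for the whole line.\<close>

definition solves :: "(real \<Rightarrow> real) \<Rightarrow> (real \<Rightarrow> real) \<Rightarrow> (real \<Rightarrow> real) \<Rightarrow> real set \<Rightarrow> bool" where
  "solves g u v T \<longleftrightarrow> (\<forall>t\<in>T. (u has_real_derivative v t) (at t within T) \<and>
     (v has_real_derivative - g (u t)) (at t within T))"

lemma solves_subset: "solves g u v T \<Longrightarrow> T' \<subseteq> T \<Longrightarrow> solves g u v T'"
  unfolding solves_def by (meson DERIV_subset subsetD)

lemma solves_continuous:
  assumes "solves g u v T"
  shows "continuous_on T u" "continuous_on T v"
  using assms unfolding solves_def by (meson DERIV_continuous_on)+

lemma solves_shift:
  assumes "solves g u v T"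
  shows "solves g (\<lambda>t. u (s + t)) (\<lambda>t. v (s + t)) {t. s + t \<in> T}"
  unfolding solves_def
proof (intro ballI conjI)
  fix t assume "t \<in> {t. s + t \<in> T}"
  then have u: "(u has_real_derivative v (s + t)) (at (s + t) within (+) s ` {t. s + t \<in> T})"
    and v: "(v has_real_derivative - g (u (s + t))) (at (s + t) within (+) s ` {t. s + t \<in> T})"
    using assms unfolding solves_def by (auto intro: DERIV_subset[where s = T])
  have "((+) s has_real_derivative 1) (at t within {t. s + t \<in> T})"
    by (auto intro!: derivative_eq_intros)
  from DERIV_image_chain[OF u this] DERIV_image_chain[OF v this]
  show "((\<lambda>t. u (s + t)) has_real_derivative v (s + t)) (at t within {t. s + t \<in> T})"
    and "((\<lambda>t. v (s + t)) has_real_derivative - g (u (s + t))) (at t within {t. s + t \<in> T})"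
    by (simp_all add: o_def)
qed

lemma solves_reflect:
  assumes "solves g u v T"
  shows "solves g (\<lambda>t. u (s - t)) (\<lambda>t. - v (s - t)) {t. s - t \<in> T}"
  unfolding solves_def
proof (intro ballI conjI)
  fix t assume "t \<in> {t. s - t \<in> T}"
  then have u: "(u has_real_derivative v (s - t)) (at (s - t) within (-) s ` {t. s - t \<in> T})"
    and v: "(v has_real_derivative - g (u (s - t))) (at (s - t) within (-) s ` {t. s - t \<in> T})"
    using assms unfolding solves_def by (auto intro: DERIV_subset[where s = T])
  have "((-) s has_real_derivative - 1) (at t within {t. s - t \<in> T})"
    by (auto intro!: derivative_eq_intros)
  from DERIV_image_chain[OF u this] DERIV_minus[OF DERIV_image_chain[OF v this]]
  show "((\<lambda>t. u (s - t)) has_real_derivative - v (s - t)) (at t within {t. s - t \<in> T})"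
    and "((\<lambda>t. - v (s - t)) has_real_derivative - g (u (s - t))) (at t within {t. s - t \<in> T})"
    by (simp_all add: o_def)
qed

lemma solves_linear_add:
  assumes "solves (\<lambda>s. c * s) u v T" "solves (\<lambda>s. c * s) u' v' T"
  shows "solves (\<lambda>s. c * s) (\<lambda>t. u t + u' t) (\<lambda>t. v t + v' t) T"
  using assms unfolding solves_def by (auto intro!: derivative_eq_intros simp: algebra_simps)

lemma solves_transform:
  assumes "solves g u v T" and u: "\<And>t. t \<in> T \<Longrightarrow> u' t = u t" and v: "\<And>t. t \<in> T \<Longrightarrow> v' t = v t"
  shows "solves g u' v' T"
  unfolding solves_def
proof (intro ballI conjI)
  fix t assume t: "t \<in> T"
  then have "(u has_real_derivative v' t) (at t within T)"
    and "(v has_real_derivative - g (u' t)) (at t within T)"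
    using assms by (auto simp: solves_def)
  then show "(u' has_real_derivative v' t) (at t within T)"
    and "(v' has_real_derivative - g (u' t)) (at t within T)"
    using t u v by (auto elim!: has_field_derivative_transform_within[OF _ zero_less_one])
qed

lemma lipschitz_neg_conj:
  fixes g :: "real \<Rightarrow> real"
  assumes "L-lipschitz_on UNIV g"
  shows "L-lipschitz_on UNIV (\<lambda>s. - g (- s))"
  using lipschitz_on_nonneg[OF assms]
proof (rule lipschitz_onI[rotated])
  show "dist (- g (- x)) (- g (- y)) \<le> L * dist x y" for x y
    using lipschitz_onD[OF assms, of "- x" "- y"] by (simp add: dist_real_def abs_minus_commute)
qed

lemma solves_neg: "solves g u v T \<Longrightarrow> solves (\<lambda>s. - g (- s)) (\<lambda>t. - u t) (\<lambda>t. - v t) T"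
  unfolding solves_def by (auto intro!: derivative_eq_intros)

lemma phase_field_lipschitz:
  fixes g :: "real \<Rightarrow> real"
  assumes g: "L-lipschitz_on UNIV g"
  shows "(1 + L)-lipschitz_on UNIV (\<lambda>z::real \<times> real. (snd z, - g (fst z)))"
proof (rule lipschitz_onI)
  show "0 \<le> 1 + L"
    using lipschitz_on_nonneg[OF g] by simp
  fix z z' :: "real \<times> real"
  have "dist (snd z, - g (fst z)) (snd z', - g (fst z')) \<le> dist (snd z) (snd z') + dist (g (fst z)) (g (fst z'))"
    unfolding dist_Pair_Pair by (rule order_trans[OF sqrt_sum_squares_le_sum]) (auto simp: dist_real_def)
  also have "\<dots> \<le> dist z z' + L * dist z z'"
    using lipschitz_on_nonneg[OF g] lipschitz_onD[OF g, of "fst z" "fst z'"]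
    by (intro add_mono dist_snd_le) (auto intro: order_trans mult_left_mono dist_fst_le)
  finally show "dist (snd z, - g (fst z)) (snd z', - g (fst z')) \<le> (1 + L) * dist z z'"
    by (simp add: algebra_simps)
qed

lemma solves_iff_phase_field:
  "solves g u v T \<longleftrightarrow> (\<forall>t\<in>T. ((\<lambda>t. (u t, v t)) has_vector_derivative
     (\<lambda>z. (snd z, - g (fst z))) (u t, v t)) (at t within T))"
proof -
  have "((\<lambda>t. (u t, v t)) has_vector_derivative (a, b)) F \<longleftrightarrow>
      (u has_vector_derivative a) F \<and> (v has_vector_derivative b) F" if "F = at t within T" for a b F t
  proof
    assume *: "((\<lambda>t. (u t, v t)) has_vector_derivative (a, b)) F"
    show "(u has_vector_derivative a) F \<and> (v has_vector_derivative b) F"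
      using bounded_linear.has_vector_derivative[OF bounded_linear_fst *]
        bounded_linear.has_vector_derivative[OF bounded_linear_snd *] by simp
  next
    assume "(u has_vector_derivative a) F \<and> (v has_vector_derivative b) F"
    then show "((\<lambda>t. (u t, v t)) has_vector_derivative (a, b)) F"
      unfolding that has_vector_derivative_def by (auto simp: scaleR_Pair intro: has_derivative_Pair)
  qed
  then show ?thesis
    by (simp add: solves_def has_real_derivative_iff_has_vector_derivative)
qed

lemma solves_exists:
  assumes "L-lipschitz_on UNIV g"
  obtains u v where "solves g u v UNIV" "u 0 = a" "v 0 = b"
proof -
  obtain x :: "real \<Rightarrow> real \<times> real" where "x 0 = (a, b)"
    and x: "\<And>t. (x has_vector_derivative (snd (x t), - g (fst (x t)))) (at t)"
    using lipschitz_ode_exists[OF phase_field_lipschitz[OF assms]] by blast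
  moreover have "solves g (\<lambda>t. fst (x t)) (\<lambda>t. snd (x t)) UNIV"
    using x by (simp add: solves_iff_phase_field)
  ultimately show thesis
    using that by force
qed

lemma solves_distance:
  assumes g: "L-lipschitz_on UNIV g"
    and "solves g u v {0..\<tau>}" "solves g u' v' {0..\<tau>}" and t: "t \<in> {0..\<tau>}"
  shows "norm (u t - u' t, v t - v' t) \<le> exp ((1 + L) * t) * norm (u 0 - u' 0, v 0 - v' 0)"
    and "norm (u 0 - u' 0, v 0 - v' 0) \<le> exp ((1 + L) * t) * norm (u t - u' t, v t - v' t)"
  using lipschitz_ode_distance[OF phase_field_lipschitz[OF g] _ _ t,
      where x = "\<lambda>t. (u t, v t)" and y = "\<lambda>t. (u' t, v' t)"] assms
  by (auto simp: solves_iff_phase_field)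

lemma solves_unique:
  assumes "L-lipschitz_on UNIV g" "solves g u v {0..\<tau>}" "solves g u' v' {0..\<tau>}"
    and "u 0 = u' 0" "v 0 = v' 0" "t \<in> {0..\<tau>}"
  shows "u t = u' t" "v t = v' t"
  using solves_distance(1)[of L g u v \<tau> u' v' t] assms by (auto simp: zero_prod_def)

text \<open>The time reversal of a solution starting with velocity \<open>0\<close> solves the same initial value problem.\<close>

lemma solves_even:
  assumes g: "L-lipschitz_on UNIV g" and uv: "solves g u v UNIV" and v0: "v 0 = 0"
  shows "u (- t) = u t" "v (- t) = - v t"
proof -
  have *: "u (- t) = u t \<and> - v (- t) = v t" if "t \<ge> 0" for t
    using solves_unique[OF g, of "\<lambda>t. u (- t)" "\<lambda>t. - v (- t)" t u v t] that v0
      solves_reflect[OF uv, of 0] solves_subset[OF uv] solves_subset[of g "\<lambda>t. u (- t)" "\<lambda>t. - v (- t)" UNIV] by simp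
  show "u (- t) = u t" "v (- t) = - v t"
    using *[of t] *[of "- t"] by (cases "t \<ge> 0"; force)+
qed

text \<open>Above the level \<open>M\<close> the force \<open>- g\<close> is the constant \<open>- c \<ge> 0\<close>, so that the explicit parabola
  below never comes back under \<open>M\<close>; by uniqueness it is the solution.\<close>

lemma trap_above:
  assumes g: "L-lipschitz_on UNIV g" and uv: "solves g u v {0..\<tau>}"
    and const: "\<And>s. s \<ge> M \<Longrightarrow> g s = c" and sign: "c \<le> 0"
    and init: "u 0 \<ge> M" "v 0 \<ge> 0" and t: "t \<in> {0..\<tau>}"
  shows "u t \<ge> M" "v t \<ge> v 0"
proof -
  define y where "y t = u 0 + v 0 * t - c * t\<^sup>2 / 2" for t
  define z where "z t = v 0 - c * t" for t
  have y: "y t \<ge> M" if "t \<ge> 0" for t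
  proof -
    have "v 0 * t \<ge> 0" "c * t\<^sup>2 \<le> 0"
      using init(2) sign that by (auto simp: mult_nonpos_nonneg)
    then show ?thesis
      using init(1) by (simp add: y_def)
  qed
  have "(y has_real_derivative z t) (at t within {0..\<tau>})"
    and "(z has_real_derivative - c) (at t within {0..\<tau>})" for t
    unfolding y_def z_def by (auto intro!: derivative_eq_intros)
  then have "solves g y z {0..\<tau>}"
    using const[OF y] by (simp add: solves_def)
  then have "u t = y t" "v t = z t"
    by (rule solves_unique[OF g uv _ _ _ t]; simp add: y_def z_def)+
  then show "u t \<ge> M" "v t \<ge> v 0"
    using y[of t] t sign by (auto simp: z_def mult_nonpos_nonneg)
qed

text \<open>After the last time at the level \<open>M\<close>, the mean value theorem yields a time at which the
  solution is above \<open>M\<close> and rising, and from there it is trapped.\<close>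

lemma overshoot_above:
  assumes g: "L-lipschitz_on UNIV g" and uv: "solves g u v UNIV"
    and const: "\<And>s. s \<ge> M \<Longrightarrow> g s = c" and sign: "c \<le> 0"
    and init: "u 0 \<le> M" and t: "t \<in> {0..\<tau>}" and over: "u t > M"
  shows "u \<tau> \<ge> M" "v \<tau> > 0"
proof -
  have ucont: "continuous_on A u" for A
    using uv by (meson DERIV_isCont UNIV_I continuous_at_imp_continuous_on solves_def)
  define t0 where "t0 = Sup {s\<in>{0..t}. u s \<le> M}"
  have "{s\<in>{0..t}. u s \<le> M} = {0..t} \<inter> u -` {..M}"
    by auto
  then have "compact {s\<in>{0..t}. u s \<le> M}"
    using continuous_closed_preimage[OF ucont, of "{0..t}" "{..M}"]
    by (metis bounded_Int bounded_closed_interval closed_atLeastAtMost closed_atMost compact_eq_bounded_closed)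
  then have "t0 \<in> {s\<in>{0..t}. u s \<le> M}"
    unfolding t0_def using init t by (intro closed_contains_Sup compact_imp_closed)
      (auto intro!: bounded_imp_bdd_above compact_imp_bounded)
  then have t0: "0 \<le> t0" "t0 \<le> t" "u t0 \<le> M"
    by auto
  have above: "u s > M" if "t0 < s" "s \<le> t" for s
  proof (rule ccontr)
    assume "\<not> u s > M"
    then have "s \<le> t0"
      unfolding t0_def using that t0 by (intro cSup_upper) (auto intro: bdd_aboveI[of _ t])
    then show False
      using that by simp
  qed
  have "t0 < t"
    using t0 over by (cases "t0 = t") auto
  then obtain s where s: "t0 < s" "s < t" "u t - u t0 = (t - t0) * v s"
    using MVT2[of t0 t u v] uv by (auto simp: solves_def)
  have "v s > 0"
    using s t0 over by (intro zero_less_mult_pos[of "t - t0" "v s"]) auto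
  moreover have "u s \<ge> M"
    using above[of s] s by simp
  ultimately have "u (s + (\<tau> - s)) \<ge> M" "v (s + (\<tau> - s)) \<ge> v (s + 0)"
    using trap_above[OF g, of "\<lambda>r. u (s + r)" "\<lambda>r. v (s + r)" "\<tau> - s" M c "\<tau> - s"]
      solves_subset[OF solves_shift[OF uv, of s], of "{0..\<tau> - s}"]
      const sign s t by auto
  then show "u \<tau> \<ge> M" "v \<tau> > 0"
    using \<open>v s > 0\<close> by auto
qed

text \<open>The mirror image of \<open>trap_above\<close> under \<open>u \<mapsto> - u\<close>, for the level \<open>0\<close>.\<close>

lemma trap_below:
  assumes g: "L-lipschitz_on UNIV g" and uv: "solves g u v UNIV"
    and null: "\<And>s. s \<le> 0 \<Longrightarrow> g s = 0" and init: "u 0 \<le> 0" "v 0 < 0" and \<tau>: "0 \<le> \<tau>"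
  shows "u \<tau> \<le> 0" "v \<tau> < 0"
proof -
  have g': "L-lipschitz_on UNIV (\<lambda>s. - g (- s))"
    by (rule lipschitz_neg_conj[OF g])
  show "u \<tau> \<le> 0" "v \<tau> < 0"
    using trap_above[OF g' solves_subset[OF solves_neg[OF uv] subset_UNIV], of 0 0 \<tau> \<tau>] null init \<tau>
    by auto
qed

text \<open>At the level \<open>0\<close> it is enough to touch: by the lower Gronwall bound a nontrivial solution cannot
  meet the zero solution, so that its velocity is nonzero at a zero of \<open>u\<close>. A positive velocity there
  would mean that \<open>u\<close> was negative shortly before, hence trapped already; so the velocity is
  negative.\<close>

lemma reach_zero:
  assumes g: "L-lipschitz_on UNIV g" and uv: "solves g u v UNIV"
    and null: "\<And>s. s \<le> 0 \<Longrightarrow> g s = 0"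
    and init: "u 0 > 0" and t: "t \<in> {0..\<tau>}" and reach: "u t \<le> 0"
  shows "u \<tau> \<le> 0" "v \<tau> < 0"
proof -
  have g': "L-lipschitz_on UNIV (\<lambda>s. - g (- s))"
    by (rule lipschitz_neg_conj[OF g])
  have below: "u \<tau> \<le> 0 \<and> v \<tau> < 0" if "s \<in> {0..\<tau>}" "u s < 0" for s \<tau>
    using overshoot_above[OF g' solves_neg[OF uv], of 0 0 s \<tau>] null init that by auto
  show "u \<tau> \<le> 0" "v \<tau> < 0"
  proof (atomize (full), cases "u t < 0")
    case True
    then show "u \<tau> \<le> 0 \<and> v \<tau> < 0"
      using below t by blast
  next
    case False
    then have ut: "u t = 0"
      using reach by simp
    have "v t < 0"
    proof (rule ccontr)
      assume "\<not> v t < 0"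
      then consider "v t = 0" | "v t > 0"
        by linarith
      then show False
      proof cases
        case 1
        have "solves g (\<lambda>t. 0) (\<lambda>t. 0) {0..\<tau>}"
          by (simp add: solves_def null)
        from solves_distance(2)[OF g solves_subset[OF uv subset_UNIV] this t] 1 ut init
        show False
          by (simp add: zero_prod_def)
      next
        case 2
        then obtain e where e: "e > 0" "\<And>h. 0 < h \<Longrightarrow> h < e \<Longrightarrow> u (t - h) < u t"
          using DERIV_pos_inc_left[of u "v t" t] uv by (auto simp: solves_def)
        have "t > 0"
          using t ut init by (cases "t = 0") auto
        define h where "h = min (e / 2) t"
        have h: "0 < h" "h < e" "h \<le> t"
          using e(1) \<open>t > 0\<close> by (auto simp: h_def)
        then have "v t < 0"
          using below[of "t - h" t] e(2)[of h] ut by simp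
        then show False
          using 2 by simp
      qed
    qed
    then show "u \<tau> \<le> 0 \<and> v \<tau> < 0"
      using trap_below[OF g _ null, of "\<lambda>r. u (t + r)" "\<lambda>r. v (t + r)" "\<tau> - t"] solves_shift[OF uv, of t] t ut by simp
  qed
qed

text \<open>The Wronskian of \<open>u\<close> and the linear solution \<open>\<psi>\<close> has the derivative \<open>\<psi> * (c * u - g u)\<close>.\<close>

lemma wronskian_decreases:
  assumes uv: "solves g u v UNIV" and \<psi>: "solves (\<lambda>s. c * s) \<psi> \<psi>' {0..\<tau>}" and \<tau>: "\<tau> > 0"
    and \<psi>_pos: "\<And>t. t \<in> {0..\<tau>} \<Longrightarrow> \<psi> t > 0"
    and super: "\<And>t. t \<in> {0..\<tau>} \<Longrightarrow> c * u t < g (u t)"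
  shows "v \<tau> * \<psi> \<tau> - u \<tau> * \<psi>' \<tau> < v 0 * \<psi> 0 - u 0 * \<psi>' 0"
proof -
  let ?W = "\<lambda>t. v t * \<psi> t - u t * \<psi>' t"
  have dW: "(?W has_real_derivative - (\<psi> t * (g (u t) - c * u t))) (at t within {0..\<tau>})"
    if "t \<in> {0..\<tau>}" for t
    using solves_subset[OF uv, of "{0..\<tau>}"] \<psi> that unfolding solves_def
    by (auto intro!: derivative_eq_intros simp: algebra_simps)
  show ?thesis
  proof (rule DERIV_neg_imp_decreasing_open[OF \<tau>, of ?W])
    show "continuous_on {0..\<tau>} ?W"
      using dW by (rule DERIV_continuous_on)
    show "\<exists>y. (?W has_real_derivative y) (at t) \<and> y < 0" if "0 < t" "t < \<tau>" for t
    proof (intro exI conjI)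
      show "(?W has_real_derivative - (\<psi> t * (g (u t) - c * u t))) (at t)"
        using dW[of t] that by (simp add: at_within_Icc_at)
      show "- (\<psi> t * (g (u t) - c * u t)) < 0"
        using \<psi>_pos[of t] super[of t] that by simp
    qed
  qed
qed

section \<open>Shooting from the centre of one patch to the centre of the next\<close>

text \<open>Shoot from the centre of a patch of type 1 with height \<open>a\<close> and slope \<open>0\<close>, cross the interface,
  and let \<open>F a\<close> be the slope on arrival at the centre of the adjacent patch of type 2. If \<open>F a = 0\<close>,
  both pieces are even about their centres, so that reflections extend them over all patches.

  The starting height \<open>M\<close> is trapped above, whence \<open>F M \<ge> 0\<close>. For a small height \<open>a\<close> the solution
  either reaches \<open>0\<close> and is trapped below, or stays in \<open>(0, \<delta>)\<close>, where the Wronskian with the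
  positive functions \<open>\<psi>1\<close>, \<open>\<psi>2\<close> decreases; since these are flat at both centres, \<open>F a < 0\<close> in either
  case. At a zero of \<open>F\<close> the two traps bound the solution for free: had it touched \<open>0\<close> or exceeded
  \<open>M\<close>, its final slope would not vanish.\<close>

lemma even_profiles_exist:
  fixes h1 h2 :: "real \<Rightarrow> real"
  assumes h1: "C1-lipschitz_on UNIV h1" and h2: "C2-lipschitz_on UNIV h2"
    and null: "\<And>s. s \<le> 0 \<Longrightarrow> h1 s = 0" "\<And>s. s \<le> 0 \<Longrightarrow> h2 s = 0"
    and const: "\<And>s. s \<ge> M \<Longrightarrow> h1 s = k1" "\<And>s. s \<ge> M \<Longrightarrow> h2 s = k2"
    and sign: "k1 \<le> 0" "k2 \<le> 0"
    and pos: "M > 0" "\<tau>1 > 0" "\<tau>2 > 0" "\<sigma> > 0" "\<delta> > 0"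
    and super: "\<And>s. 0 < s \<Longrightarrow> s < \<delta> \<Longrightarrow> c1 * s < h1 s" "\<And>s. 0 < s \<Longrightarrow> s < \<delta> \<Longrightarrow> c2 * s < h2 s"
    and \<psi>1: "solves (\<lambda>s. c1 * s) \<psi>1 \<psi>1' {0..\<tau>1}" "\<And>t. t \<in> {0..\<tau>1} \<Longrightarrow> \<psi>1 t > 0" "\<psi>1' 0 = 0"
    and \<psi>2: "solves (\<lambda>s. c2 * s) \<psi>2 \<psi>2' {0..\<tau>2}" "\<And>t. t \<in> {0..\<tau>2} \<Longrightarrow> \<psi>2 t > 0" "\<psi>2' \<tau>2 = 0"
    and match: "\<psi>1 \<tau>1 = \<psi>2 0" "\<psi>1' \<tau>1 = \<sigma> * \<psi>2' 0"
  obtains A A' B B' where "solves h1 A A' UNIV" "solves h2 B B' UNIV"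
    "\<And>t. A (- t) = A t" "\<And>t. A' (- t) = - A' t" "\<And>t. B (- t) = B t" "\<And>t. B' (- t) = - B' t"
    "A \<tau>1 = B \<tau>2" "A' \<tau>1 = - \<sigma> * B' \<tau>2"
    "\<And>t. \<bar>t\<bar> \<le> \<tau>1 \<Longrightarrow> 0 < A t \<and> A t \<le> M" "\<And>t. \<bar>t\<bar> \<le> \<tau>2 \<Longrightarrow> 0 < B t \<and> B t \<le> M"
proof -
  have "\<forall>a. \<exists>u v. solves h1 u v UNIV \<and> u 0 = a \<and> v 0 = 0"
    using solves_exists[OF h1] by metis
  then obtain U1 V1 where S1: "\<And>a. solves h1 (U1 a) (V1 a) UNIV"
    and init1: "\<And>a. U1 a 0 = a" "\<And>a. V1 a 0 = 0"
    by metis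
  have "\<forall>a. \<exists>u v. solves h2 u v UNIV \<and> u 0 = U1 a \<tau>1 \<and> v 0 = V1 a \<tau>1 / \<sigma>"
    using solves_exists[OF h2] by metis
  then obtain U2 V2 where S2: "\<And>a. solves h2 (U2 a) (V2 a) UNIV"
    and init2: "\<And>a. U2 a 0 = U1 a \<tau>1" "\<And>a. V2 a 0 = V1 a \<tau>1 / \<sigma>"
    by metis
  note S1' = solves_subset[OF S1 subset_UNIV] and S2' = solves_subset[OF S2 subset_UNIV]
  define F where "F a = V2 a \<tau>2" for a

  define E1 where "E1 = exp ((1 + C1) * \<tau>1)"
  define D where "D = max E1 (exp ((1 + C2) * \<tau>2) * (E1 + E1 / \<sigma>))"
  have C: "C1 \<ge> 0" "C2 \<ge> 0"
    using lipschitz_on_nonneg h1 h2 by blast+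
  \<comment> \<open>Lipschitz dependence on the starting height \<open>a\<close>: through the first patch with the constant \<open>E1\<close>, and after the jump of the slope through the second patch as well.\<close>
  have near1: "norm (U1 a t - U1 b t, V1 a t - V1 b t) \<le> E1 * \<bar>a - b\<bar>" if t: "t \<in> {0..\<tau>1}" for a b t
  proof -
    have "norm (U1 a t - U1 b t, V1 a t - V1 b t) \<le> exp ((1 + C1) * t) * \<bar>a - b\<bar>"
      using solves_distance(1)[OF h1 S1' S1' t, of a b] by (simp add: init1 norm_prod_def)
    also have "\<dots> \<le> E1 * \<bar>a - b\<bar>"
      using t C unfolding E1_def by (intro mult_right_mono) auto
    finally show ?thesis .
  qed
  have near2: "norm (U2 a t - U2 b t, V2 a t - V2 b t) \<le> D * \<bar>a - b\<bar>" if t: "t \<in> {0..\<tau>2}" for a b t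
  proof -
    have "norm (U2 a t - U2 b t, V2 a t - V2 b t)
        \<le> exp ((1 + C2) * t) * norm (U1 a \<tau>1 - U1 b \<tau>1, V1 a \<tau>1 / \<sigma> - V1 b \<tau>1 / \<sigma>)"
      using solves_distance(1)[OF h2 S2' S2' t, of a b] by (simp add: init2)
    also have "norm (U1 a \<tau>1 - U1 b \<tau>1, V1 a \<tau>1 / \<sigma> - V1 b \<tau>1 / \<sigma>)
        \<le> \<bar>U1 a \<tau>1 - U1 b \<tau>1\<bar> + \<bar>V1 a \<tau>1 - V1 b \<tau>1\<bar> / \<sigma>"
      using norm_Pair_le[of "U1 a \<tau>1 - U1 b \<tau>1" "V1 a \<tau>1 / \<sigma> - V1 b \<tau>1 / \<sigma>"] pos
      by (simp flip: diff_divide_distrib)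
    also have "\<dots> \<le> E1 * \<bar>a - b\<bar> + E1 * \<bar>a - b\<bar> / \<sigma>"
      using near1[of \<tau>1 a b] norm_fst_le[of "U1 a \<tau>1 - U1 b \<tau>1" "V1 a \<tau>1 - V1 b \<tau>1"]
        norm_snd_le[of "V1 a \<tau>1 - V1 b \<tau>1" "U1 a \<tau>1 - U1 b \<tau>1"] pos
      by (intro add_mono divide_right_mono) auto
    also have "exp ((1 + C2) * t) * \<dots> \<le> exp ((1 + C2) * \<tau>2) * (E1 * \<bar>a - b\<bar> + E1 * \<bar>a - b\<bar> / \<sigma>)"
      using t C pos by (intro mult_right_mono) (auto simp: E1_def)
    also have "\<dots> = exp ((1 + C2) * \<tau>2) * (E1 + E1 / \<sigma>) * \<bar>a - b\<bar>"
      by (simp add: algebra_simps)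
    also have "\<dots> \<le> D * \<bar>a - b\<bar>"
      unfolding D_def by (intro mult_right_mono) auto
    finally show ?thesis
      by (simp add: mult_left_mono)
  qed
  have close1: "\<bar>U1 a t - U1 b t\<bar> \<le> D * \<bar>a - b\<bar>" if "t \<in> {0..\<tau>1}" for a b t
  proof -
    have "E1 * \<bar>a - b\<bar> \<le> D * \<bar>a - b\<bar>"
      unfolding D_def by (intro mult_right_mono) auto
    then show ?thesis
      using near1[OF that, of a b] norm_fst_le[of "U1 a t - U1 b t" "V1 a t - V1 b t"] by simp
  qed
  have close2: "\<bar>U2 a t - U2 b t\<bar> \<le> D * \<bar>a - b\<bar>" "\<bar>V2 a t - V2 b t\<bar> \<le> D * \<bar>a - b\<bar>"
    if "t \<in> {0..\<tau>2}" for a b t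
    using near2[OF that, of a b] norm_fst_le[of "U2 a t - U2 b t" "V2 a t - V2 b t"]
      norm_snd_le[of "V2 a t - V2 b t" "U2 a t - U2 b t"] by auto
  have D: "D > 0"
    by (simp add: D_def E1_def less_max_iff_disj)

  have F_cont: "continuous_on X F" for X
  proof (rule lipschitz_on_continuous_on)
    show "D-lipschitz_on X F"
      using close2(2)[of \<tau>2] pos D by (intro lipschitz_onI) (auto simp: F_def dist_real_def)
  qed
  have zero: "solves h1 (\<lambda>t. 0) (\<lambda>t. 0) X" "solves h2 (\<lambda>t. 0) (\<lambda>t. 0) X" for X
    by (simp_all add: solves_def null)
  have zero1: "U1 0 t = 0" "V1 0 t = 0" if "t \<in> {0..\<tau>1}" for t
    using solves_unique[OF h1 S1' zero(1) _ _ that] init1 by auto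
  have zero2: "U2 0 t = 0" if "t \<in> {0..\<tau>2}" for t
    using solves_unique(1)[OF h2 S2' zero(2) _ _ that] init2 zero1[of \<tau>1] pos by auto

  have stays_pos: "(\<forall>t\<in>{0..\<tau>1}. U1 a t > 0) \<and> (\<forall>t\<in>{0..\<tau>2}. U2 a t > 0)"
    if a: "a > 0" and Fa: "F a \<ge> 0" for a
  proof -
    have pos1: "U1 a t > 0" if "t \<in> {0..\<tau>1}" for t
    proof (rule ccontr)
      assume "\<not> U1 a t > 0"
      then have "U1 a \<tau>1 \<le> 0" "V1 a \<tau>1 < 0"
        using reach_zero[OF h1 S1 null(1) _ that, of a] a init1 by auto
      then have "V2 a \<tau>2 < 0"
        using trap_below(2)[OF h2 S2 null(2), of a \<tau>2] pos init2 by (simp add: divide_neg_pos)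
      then show False
        using Fa by (simp add: F_def)
    qed
    moreover have "U2 a t > 0" if "t \<in> {0..\<tau>2}" for t
    proof (rule ccontr)
      assume "\<not> U2 a t > 0"
      then have "V2 a \<tau>2 < 0"
        using reach_zero(2)[OF h2 S2 null(2) _ that, of a] pos1[of \<tau>1] pos init2 by simp
      then show False
        using Fa by (simp add: F_def)
    qed
    ultimately show ?thesis
      by blast
  qed
  have stays_below: "(\<forall>t\<in>{0..\<tau>1}. U1 a t \<le> M) \<and> (\<forall>t\<in>{0..\<tau>2}. U2 a t \<le> M)"
    if a: "a \<le> M" and Fa: "F a \<le> 0" for a
  proof -
    have below1: "U1 a t \<le> M" if "t \<in> {0..\<tau>1}" for t
    proof (rule ccontr)
      assume "\<not> U1 a t \<le> M"
      then have "U1 a \<tau>1 \<ge> M" "V1 a \<tau>1 > 0"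
        using overshoot_above[OF h1 S1[of a], of M k1 t \<tau>1] const(1) sign(1) that a init1 by auto
      then have "V2 a \<tau>2 \<ge> V1 a \<tau>1 / \<sigma>" "V1 a \<tau>1 / \<sigma> > 0"
        using trap_above(2)[OF h2 S2'[of a], of M k2 \<tau>2 \<tau>2] const(2) sign(2) pos init2 by simp_all
      then show False
        using Fa by (simp add: F_def)
    qed
    moreover have "U2 a t \<le> M" if "t \<in> {0..\<tau>2}" for t
    proof (rule ccontr)
      assume "\<not> U2 a t \<le> M"
      then have "V2 a \<tau>2 > 0"
        using overshoot_above(2)[OF h2 S2[of a], of M k2 t \<tau>2] const(2) sign(2) that below1[of \<tau>1] pos init2 by simp
      then show False
        using Fa by (simp add: F_def)
    qed
    ultimately show ?thesis
      by blast
  qed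

  have F_large: "F M \<ge> 0"
  proof -
    have "U1 M \<tau>1 \<ge> M" "V1 M \<tau>1 \<ge> 0"
      using trap_above[OF h1 S1'[of M], of M k1 \<tau>1 \<tau>1] const(1) sign(1) pos init1 by simp_all
    then show ?thesis
      using trap_above(2)[OF h2 S2'[of M], of M k2 \<tau>2 \<tau>2] const(2) sign(2) pos init2
      by (simp add: F_def) (meson divide_nonneg_pos order_trans)
  qed
  \<comment> \<open>By the Lipschitz dependence and \<open>U1 0 = 0\<close>, \<open>U2 0 = 0\<close>, this height keeps the solution below \<open>\<delta>\<close>.\<close>
  define a0 where "a0 = min M (\<delta> / (D + 1))"
  have a0: "0 < a0" "a0 \<le> M"
    using pos D by (auto simp: a0_def)
  have Da0: "D * \<bar>a0 - 0\<bar> < \<delta>"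
  proof -
    have "D * a0 \<le> D * (\<delta> / (D + 1))"
      using D by (intro mult_left_mono) (auto simp: a0_def)
    also have "\<dots> < \<delta>"
      using D pos by (simp add: field_simps)
    finally show ?thesis
      using a0 by simp
  qed
  have F_small: "F a0 < 0"
  proof (rule ccontr)
    assume "\<not> F a0 < 0"
    then have U_pos: "\<And>t. t \<in> {0..\<tau>1} \<Longrightarrow> U1 a0 t > 0" "\<And>t. t \<in> {0..\<tau>2} \<Longrightarrow> U2 a0 t > 0"
      using stays_pos[OF a0(1)] by auto
    have small1: "U1 a0 t < \<delta>" if "t \<in> {0..\<tau>1}" for t
      using close1[OF that, of a0 0] zero1[OF that] Da0 by simp
    have small2: "U2 a0 t < \<delta>" if "t \<in> {0..\<tau>2}" for t
      using close2(1)[OF that, of a0 0] zero2[OF that] Da0 by simp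
    have "V1 a0 \<tau>1 * \<psi>1 \<tau>1 - U1 a0 \<tau>1 * \<psi>1' \<tau>1 < 0"
      using wronskian_decreases[OF S1 \<psi>1(1) pos(2) \<psi>1(2) super(1)[OF U_pos(1) small1]]
      by (simp add: init1 \<psi>1(3))
    then have "(V1 a0 \<tau>1 * \<psi>1 \<tau>1 - U1 a0 \<tau>1 * \<psi>1' \<tau>1) / \<sigma> < 0"
      using pos by (simp add: divide_neg_pos)
    then have "V2 a0 0 * \<psi>2 0 - U2 a0 0 * \<psi>2' 0 < 0"
      using pos by (simp add: init2 match diff_divide_distrib mult.left_commute)
    moreover have "V2 a0 \<tau>2 * \<psi>2 \<tau>2 < V2 a0 0 * \<psi>2 0 - U2 a0 0 * \<psi>2' 0"
      using wronskian_decreases[OF S2 \<psi>2(1) pos(3) \<psi>2(2) super(2)[OF U_pos(2) small2]]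
      by (simp add: \<psi>2(3))
    ultimately have "F a0 * \<psi>2 \<tau>2 < 0"
      by (simp add: F_def)
    then show False
      using \<psi>2(2)[of \<tau>2] pos \<open>\<not> F a0 < 0\<close> by (simp add: mult_less_0_iff)
  qed
  obtain a where a: "a0 \<le> a" "a \<le> M" "F a = 0"
    using IVT'[of F a0 0 M] F_small F_large F_cont a0 by auto
  then have a_pos: "a > 0"
    using a0 by simp
  have bounds1: "0 < U1 a t \<and> U1 a t \<le> M" if "t \<in> {0..\<tau>1}" for t
    using stays_pos[OF a_pos] stays_below[OF a(2)] a(3) that by simp
  have bounds2: "0 < U2 a t \<and> U2 a t \<le> M" if "t \<in> {0..\<tau>2}" for t
    using stays_pos[OF a_pos] stays_below[OF a(2)] a(3) that by simp
  define B where "B t = U2 a (\<tau>2 + t)" for t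
  define B' where "B' t = V2 a (\<tau>2 + t)" for t
  have SB: "solves h2 B B' UNIV"
    unfolding B_def B'_def using solves_shift[OF S2[of a], of \<tau>2] by simp
  have B'0: "B' 0 = 0"
    using a(3) by (simp add: B'_def F_def)
  note evenA = solves_even[OF h1 S1 init1(2), of a]
  note evenB = solves_even[OF h2 SB B'0]
  show thesis
  proof (rule that[of "U1 a" "V1 a" B B', OF S1 SB evenA evenB])
    have "B \<tau>2 = U2 a 0" "B' \<tau>2 = - V2 a 0"
      using evenB(1)[of "- \<tau>2"] evenB(2)[of "- \<tau>2"] by (simp_all add: B_def B'_def)
    then show "U1 a \<tau>1 = B \<tau>2" "V1 a \<tau>1 = - \<sigma> * B' \<tau>2"
      using pos by (simp_all add: init2)
    show "0 < U1 a t \<and> U1 a t \<le> M" if "\<bar>t\<bar> \<le> \<tau>1" for t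
      using bounds1[of "\<bar>t\<bar>"] that evenA(1)[of t] by (simp add: abs_if split: if_splits)
    show "0 < B t \<and> B t \<le> M" if "\<bar>t\<bar> \<le> \<tau>2" for t
      using bounds2[of "\<tau>2 - \<bar>t\<bar>"] that evenB(1)[of "\<bar>t\<bar>"] by (simp add: B_def abs_if split: if_splits)
  qed
qed

section \<open>Patch geometry and the flux\<close>

text \<open>The derivatives at an end point that \<open>left_lim\<close> and \<open>right_lim\<close> pick out are the derivatives
  within the closed interval, because \<open>deriv p\<close> agrees in the interior with a function that is
  continuous up to the end points.\<close>

lemma deriv_on_patch:
  fixes p :: "real \<Rightarrow> real"
  assumes ab: "\<alpha> < \<beta>"
    and p: "\<And>x. x \<in> {\<alpha>..\<beta>} \<Longrightarrow> (p has_real_derivative p' x) (at x within {\<alpha>..\<beta>})"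
    and p': "\<And>x. x \<in> {\<alpha>..\<beta>} \<Longrightarrow> (p' has_real_derivative p'' x) (at x within {\<alpha>..\<beta>})"
  shows "x \<in> {\<alpha><..<\<beta>} \<Longrightarrow> deriv (deriv p) x = p'' x"
    and "x \<in> {\<alpha><..\<beta>} \<Longrightarrow> left_lim p x = p x" "x \<in> {\<alpha>..<\<beta>} \<Longrightarrow> right_lim p x = p x"
    and "x \<in> {\<alpha><..\<beta>} \<Longrightarrow> left_lim (deriv p) x = p' x"
    and "x \<in> {\<alpha>..<\<beta>} \<Longrightarrow> right_lim (deriv p) x = p' x"
proof -
  have d: "deriv p x = p' x" if "x \<in> {\<alpha><..<\<beta>}" for x
    using p[of x] that by (auto intro!: DERIV_imp_deriv simp: at_within_Icc_at)
  show "deriv (deriv p) x = p'' x" if "x \<in> {\<alpha><..<\<beta>}"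
  proof -
    have "(p' has_real_derivative p'' x) (at x)"
      using p'[of x] that by (simp add: at_within_Icc_at)
    then have "(deriv p has_real_derivative p'' x) (at x)"
      by (rule has_field_derivative_transform_within_open[where S = "{\<alpha><..<\<beta>}"]) (use that d in auto)
    then show ?thesis
      by (rule DERIV_imp_deriv)
  qed
  have left: "left_lim h x = g x" if "continuous_on {\<alpha>..\<beta>} g" "x \<in> {\<alpha><..\<beta>}"
    "\<And>y. y \<in> {\<alpha><..<\<beta>} \<Longrightarrow> h y = g y" for h g :: "real \<Rightarrow> real"
  proof -
    have "continuous_on {\<alpha>..x} g"
      by (rule continuous_on_subset[OF that(1)]) (use that(2) in auto)
    then have "(g \<longlongrightarrow> g x) (at_left x)"
      using that(2) by (intro continuous_on_Icc_at_leftD[where a = \<alpha>]) auto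
    moreover have "\<forall>\<^sub>F y in at_left x. h y = g y"
      using that(2) by (intro eventually_at_leftI[of \<alpha>] that(3)) auto
    ultimately have "(h \<longlongrightarrow> g x) (at_left x)"
      by (simp add: tendsto_cong)
    then show ?thesis
      unfolding left_lim_def by (intro tendsto_Lim) auto
  qed
  have right: "right_lim h x = g x" if "continuous_on {\<alpha>..\<beta>} g" "x \<in> {\<alpha>..<\<beta>}"
    "\<And>y. y \<in> {\<alpha><..<\<beta>} \<Longrightarrow> h y = g y" for h g :: "real \<Rightarrow> real"
  proof -
    have "continuous_on {x..\<beta>} g"
      by (rule continuous_on_subset[OF that(1)]) (use that(2) in auto)
    then have "(g \<longlongrightarrow> g x) (at_right x)"
      using that(2) by (intro continuous_on_Icc_at_rightD[where b = \<beta>]) auto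
    moreover have "\<forall>\<^sub>F y in at_right x. h y = g y"
      using that(2) by (intro eventually_at_rightI[of _ \<beta>] that(3)) auto
    ultimately have "(h \<longlongrightarrow> g x) (at_right x)"
      by (simp add: tendsto_cong)
    then show ?thesis
      unfolding right_lim_def by (intro tendsto_Lim) auto
  qed
  note cont = DERIV_continuous_on[OF p] DERIV_continuous_on[OF p']
  show "x \<in> {\<alpha><..\<beta>} \<Longrightarrow> left_lim p x = p x" "x \<in> {\<alpha>..<\<beta>} \<Longrightarrow> right_lim p x = p x"
    and "x \<in> {\<alpha><..\<beta>} \<Longrightarrow> left_lim (deriv p) x = p' x"
    and "x \<in> {\<alpha>..<\<beta>} \<Longrightarrow> right_lim (deriv p) x = p' x"
    using left[OF cont(1)] right[OF cont(1)] left[OF cont(2)] right[OF cont(2)] d by blast+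
qed

lemma solves_one_sided:
  assumes ab: "\<alpha> < \<beta>" and "solves N p p' {\<alpha>..\<beta>}"
  shows "x \<in> {\<alpha><..<\<beta>} \<Longrightarrow> deriv (deriv p) x = - N (p x)"
    and "x \<in> {\<alpha><..\<beta>} \<Longrightarrow> left_lim p x = p x" "x \<in> {\<alpha>..<\<beta>} \<Longrightarrow> right_lim p x = p x"
    and "x \<in> {\<alpha><..\<beta>} \<Longrightarrow> left_lim (deriv p) x = p' x"
    and "x \<in> {\<alpha>..<\<beta>} \<Longrightarrow> right_lim (deriv p) x = p' x"
  using deriv_on_patch[OF ab, of p p' "\<lambda>x. - N (p x)" x] assms(2) by (simp_all add: solves_def)

locale two_patches =
  fixes l1 l2 :: real
  assumes l1: "l1 > 0" and l2: "l2 > 0"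
begin

abbreviation l :: real where "l \<equiv> l1 + l2"

definition P1 :: "int \<Rightarrow> real set" where "P1 n = {of_int n * l - l1..of_int n * l}"

definition P2 :: "int \<Rightarrow> real set" where "P2 n = {of_int n * l..of_int n * l + l2}"

lemma patch_index_cases:
  obtains n where "x \<in> {of_int n * l - l1..<of_int n * l}"
  | n where "x \<in> {of_int n * l..<of_int n * l + l2}"
proof -
  define n where "n = \<lfloor>(x + l1) / l\<rfloor>"
  have "of_int n \<le> (x + l1) / l" "(x + l1) / l < of_int n + 1"
    unfolding n_def by linarith+
  then have "of_int n * l \<le> x + l1" "x + l1 < of_int n * l + l"
    using l1 l2 by (simp_all add: field_simps)
  then show thesis
    using that(1)[of n] that(2)[of n] by (cases "x < of_int n * l") auto
qed

text \<open>Distinct multiples of the period are at least one period apart. This settles all disjointness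
  questions between patches and interfaces.\<close>

lemma multiple_less_cases:
  fixes m n :: int
  obtains "m = n" | "of_int m * l + l \<le> of_int n * l" | "of_int n * l + l \<le> of_int m * l"
proof -
  have *: "of_int j * l + l \<le> of_int k * l" if "j < k" for j k :: int
  proof -
    have "(of_int j + 1) * l \<le> of_int k * l"
      using that l1 l2 by (intro mult_right_mono) linarith+
    then show ?thesis
      by (simp add: algebra_simps)
  qed
  show thesis
    using that *[of m n] *[of n m] by (cases m n rule: linorder_cases) auto
qed

lemma patchwise_P1: "x \<in> {of_int n * l - l1<..<of_int n * l} \<Longrightarrow> patchwise l1 l2 a b x = a"
  unfolding patchwise_def patches1_def by auto

lemma patchwise_P2:
  assumes "x \<in> {of_int n * l<..<of_int n * l + l2}"
  shows "patchwise l1 l2 a b x = b"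
proof -
  have "x \<notin> {of_int m * l - l1<..<of_int m * l}" for m
    using assms l1 l2 by (cases m n rule: multiple_less_cases) auto
  then show ?thesis
    unfolding patchwise_def patches1_def by auto
qed

lemma interior_not_interface:
  assumes "x \<in> {of_int n * l - l1<..<of_int n * l} \<or> x \<in> {of_int n * l<..<of_int n * l + l2}"
  shows "x \<notin> interfaces l1 l2"
proof -
  have "x \<noteq> of_int m * l" "x \<noteq> l2 + of_int m * l" for m
    using assms l1 l2 by (cases m n rule: multiple_less_cases; auto)+
  then show ?thesis
    unfolding interfaces_def S1_def S2_def by auto
qed

lemma non_interface_cases:
  assumes "x \<notin> interfaces l1 l2"
  obtains n where "x \<in> {of_int n * l - l1<..<of_int n * l}"
  | n where "x \<in> {of_int n * l<..<of_int n * l + l2}"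
proof -
  have x: "x \<noteq> of_int n * l" "x \<noteq> l2 + of_int n * l" for n
    using assms unfolding interfaces_def S1_def S2_def by auto
  show thesis
  proof (cases rule: patch_index_cases[of x])
    case (1 n)
    then show thesis
      using that(1)[of n] x(2)[of "n - 1"] by (auto simp: algebra_simps less_le)
  next
    case (2 n)
    then show thesis
      using that(2)[of n] x(1)[of n] by (auto simp: less_le)
  qed
qed

lemma all_patches_closure_iff:
  "(\<forall>I\<in>patches l1 l2. Q (closure I)) \<longleftrightarrow> (\<forall>n. Q (P1 n)) \<and> (\<forall>n. Q (P2 n))"
  using l1 l2 by (simp add: patches_def patches1_def patches2_def ball_Un P1_def P2_def)

lemma finite_interfaces: "finite (interfaces l1 l2 \<inter> {a..b})"
proof -
  have "finite (range (\<lambda>n::int. s + of_int n * l) \<inter> {a..b})" for s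
  proof (rule finite_subset)
    show "range (\<lambda>n::int. s + of_int n * l) \<inter> {a..b}
        \<subseteq> (\<lambda>n::int. s + of_int n * l) ` {\<lfloor>(a - s) / l\<rfloor>..\<lceil>(b - s) / l\<rceil>}"
    proof
      fix x assume "x \<in> range (\<lambda>n::int. s + of_int n * l) \<inter> {a..b}"
      then obtain n :: int where n: "x = s + of_int n * l" and "a \<le> x" "x \<le> b"
        by auto
      then have "(a - s) / l \<le> of_int n" "of_int n \<le> (b - s) / l"
        using l1 l2 by (simp_all add: field_simps)
      then have "n \<in> {\<lfloor>(a - s) / l\<rfloor>..\<lceil>(b - s) / l\<rceil>}"
        unfolding atLeastAtMost_iff by linarith
      then show "x \<in> (\<lambda>n::int. s + of_int n * l) ` {\<lfloor>(a - s) / l\<rfloor>..\<lceil>(b - s) / l\<rceil>}"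
        using n by blast
    qed
  qed simp
  from this[of 0] this[of l2] show ?thesis
    by (simp add: interfaces_def S1_def S2_def Int_Un_distrib2)
qed

lemma continuous_on_patches:
  fixes g :: "real \<Rightarrow> real"
  assumes "\<And>n. continuous_on (P1 n) g" "\<And>n. continuous_on (P2 n) g"
  shows "continuous_on UNIV g"
  unfolding continuous_on_eq_continuous_at[OF open_UNIV]
proof
  fix x
  obtain n where n: "x \<in> {of_int n * l - l1..<of_int n * l + l2}"
  proof (cases rule: patch_index_cases[of x])
    case (1 n)
    then show ?thesis using that[of n] l2 by auto
  next
    case (2 n)
    then show ?thesis using that[of n] l1 by auto
  qed
  let ?U = "P1 n \<union> P2 n \<union> P2 (n - 1)"
  have "continuous_on ?U g"
    using assms(1)[of n] assms(2)[of n] assms(2)[of "n - 1"]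
    by (intro continuous_on_closed_Un) (auto simp: P1_def P2_def)
  moreover have "x \<in> interior ?U"
  proof (rule interiorI)
    show "open {of_int n * l - l<..<of_int n * l + l2}" "x \<in> {of_int n * l - l<..<of_int n * l + l2}"
      using n l2 by auto
    show "{of_int n * l - l<..<of_int n * l + l2} \<subseteq> ?U"
      by (auto simp: P1_def P2_def algebra_simps)
  qed
  ultimately show "isCont g x"
    by (rule continuous_on_interior)
qed

text \<open>Interfaces are locally finite, so that derivative bounds that hold off the interfaces can be
  integrated across them when the function is continuous.\<close>

lemma growth_off_interfaces:
  fixes g :: "real \<Rightarrow> real"
  assumes "a \<le> b" and g: "continuous_on UNIV g"
    and g': "\<And>x. a < x \<Longrightarrow> x < b \<Longrightarrow> x \<notin> interfaces l1 l2 \<Longrightarrow> (g has_real_derivative g' x) (at x)"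
    and ge: "\<And>x. a < x \<Longrightarrow> x < b \<Longrightarrow> x \<notin> interfaces l1 l2 \<Longrightarrow> g' x \<ge> c"
  shows "g b - g a \<ge> c * (b - a)"
proof -
  let ?S = "interfaces l1 l2 \<inter> {a..b}"
  define h where "h x = (if x \<in> {a<..<b} - ?S then g' x - c else 0)" for x
  have "(h has_integral (g b - c * b) - (g a - c * a)) {a..b}"
  proof (rule fundamental_theorem_of_calculus_interior_strong[OF finite_interfaces \<open>a \<le> b\<close>])
    show "continuous_on {a..b} (\<lambda>x. g x - c * x)"
      by (intro continuous_intros continuous_on_subset[OF g]) auto
    show "((\<lambda>x. g x - c * x) has_vector_derivative h x) (at x)" if "x \<in> {a<..<b} - ?S" for x
    proof -
      have "((\<lambda>x. g x - c * x) has_real_derivative g' x - c) (at x)"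
        using that by (auto intro!: derivative_eq_intros g')
      then show ?thesis
        using that unfolding h_def has_real_derivative_iff_has_vector_derivative by (subst if_P)
    qed
  qed
  then have "0 \<le> (g b - c * b) - (g a - c * a)"
    by (rule has_integral_nonneg) (auto simp: h_def intro!: ge)
  then show ?thesis
    by (simp add: algebra_simps)
qed

text \<open>An equation in the open interval extends to the one-sided second derivatives at the end points
  by continuity.\<close>

lemma Ck_on_2_solves:
  assumes "\<alpha> < \<beta>" and C2: "Ck_on 2 p {\<alpha>..\<beta>}" and N: "continuous_on UNIV N"
    and eq: "\<And>x. x \<in> {\<alpha><..<\<beta>} \<Longrightarrow> deriv (deriv p) x = - N (p x)"
  obtains p' where "solves N p p' {\<alpha>..\<beta>}"
    "\<And>x. x \<in> {\<alpha>..<\<beta>} \<Longrightarrow> right_lim (deriv p) x = p' x" "left_lim (deriv p) \<beta> = p' \<beta>"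
proof -
  obtain D where D0: "D 0 = p"
    and D: "\<And>j x. j < 2 \<Longrightarrow> x \<in> {\<alpha>..\<beta>} \<Longrightarrow> (D j has_real_derivative D (Suc j) x) (at x within {\<alpha>..\<beta>})"
    and D2: "continuous_on {\<alpha>..\<beta>} (D 2)"
    using C2 unfolding Ck_on_def by auto
  have p: "(p has_real_derivative D 1 x) (at x within {\<alpha>..\<beta>})"
    and p': "(D 1 has_real_derivative D 2 x) (at x within {\<alpha>..\<beta>})" if "x \<in> {\<alpha>..\<beta>}" for x
    using D[of 0 x] D[of 1 x] that by (auto simp: D0 numeral_2_eq_2)
  note * = deriv_on_patch[OF \<open>\<alpha> < \<beta>\<close> p p']
  have D2': "D 2 x = - N (p x)" if "x \<in> {\<alpha>..\<beta>}" for x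
  proof -
    have "continuous_on (closure {\<alpha><..<\<beta>}) (\<lambda>x. D 2 x + N (p x))"
      using \<open>\<alpha> < \<beta>\<close>
      by (auto intro!: continuous_intros D2 continuous_on_compose2[OF N] DERIV_continuous_on[OF p])
    then have "D 2 x + N (p x) = 0"
      by (rule continuous_constant_on_closure) (use eq *(1) that \<open>\<alpha> < \<beta>\<close> in \<open>fastforce+\<close>)
    then show ?thesis
      by simp
  qed
  show thesis
  proof (rule that)
    show "solves N p (D 1) {\<alpha>..\<beta>}"
      using p p' D2' by (simp add: solves_def)
  qed (use * \<open>\<alpha> < \<beta>\<close> in auto)
qed

text \<open>The jump conditions say that the flux, which is \<open>p'\<close> in patches of type 1 and \<open>\<sigma> * p'\<close> in
  patches of type 2, is continuous across all interfaces. With it the problem becomes a first-order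
  system for two continuous functions.\<close>

lemma flux_exists:
  assumes \<sigma>: "\<sigma> > 0" and N: "continuous_on UNIV N1" "continuous_on UNIV N2"
    and C2: "\<forall>I\<in>patches l1 l2. Ck_on 2 p (closure I)"
    and eq: "\<And>x. x \<notin> interfaces l1 l2 \<Longrightarrow> deriv (deriv p) x = - patchwise l1 l2 N1 N2 x (p x)"
    and S1: "\<And>x. x \<in> S1 l1 l2 \<Longrightarrow> left_lim (deriv p) x = \<sigma> * right_lim (deriv p) x"
    and S2: "\<And>x. x \<in> S2 l1 l2 \<Longrightarrow> \<sigma> * left_lim (deriv p) x = right_lim (deriv p) x"
  obtains q where "continuous_on UNIV q" "\<And>n. solves N1 p q (P1 n)"
    "\<And>n. solves N2 p (\<lambda>x. q x / \<sigma>) (P2 n)"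
proof -
  \<comment> \<open>The right limit fixes the value at each interface by the patch to its right; the jump conditions make it agree with the flux from the left.\<close>
  define q where "q x = (if \<exists>n. x \<in> {of_int n * l - l1..<of_int n * l} then 1 else \<sigma>) * right_lim (deriv p) x" for x
  have q1: "q x = right_lim (deriv p) x" if "x \<in> {of_int n * l - l1..<of_int n * l}" for x n
    using that by (auto simp: q_def)
  have q2: "q x = \<sigma> * right_lim (deriv p) x" if "x \<in> {of_int n * l..<of_int n * l + l2}" for x n
  proof -
    have "x \<notin> {of_int m * l - l1..<of_int m * l}" for m
      using that l1 l2 by (cases m n rule: multiple_less_cases) auto
    then show ?thesis
      by (auto simp: q_def)
  qed
  have 1: "solves N1 p q (P1 n)" for n
  proof -
    have "of_int n * l - l1 < of_int n * l"
      using l1 by simp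
    then obtain p' where p': "solves N1 p p' {of_int n * l - l1..of_int n * l}"
      "\<And>x. x \<in> {of_int n * l - l1..<of_int n * l} \<Longrightarrow> right_lim (deriv p) x = p' x"
      "left_lim (deriv p) (of_int n * l) = p' (of_int n * l)"
      using Ck_on_2_solves[OF _ _ N(1), of "of_int n * l - l1" "of_int n * l" p]
        C2 eq interior_not_interface patchwise_P1
      unfolding all_patches_closure_iff P1_def by metis
    have "q x = p' x" if "x \<in> {of_int n * l - l1..of_int n * l}" for x
    proof (cases "x = of_int n * l")
      case True
      then have "x \<in> S1 l1 l2" "x \<in> {of_int n * l..<of_int n * l + l2}"
        using l2 by (auto simp: S1_def)
      then show ?thesis
        using p'(3) S1 q2 True by metis
    next
      case False
      then show ?thesis
        using that p'(2) q1[of x n] by simp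
    qed
    then show ?thesis
      using solves_transform[OF p'(1)] unfolding P1_def by simp
  qed
  have 2: "solves N2 p (\<lambda>x. q x / \<sigma>) (P2 n)" for n
  proof -
    have "of_int n * l < of_int n * l + l2"
      using l2 by simp
    then obtain p' where p': "solves N2 p p' {of_int n * l..of_int n * l + l2}"
      "\<And>x. x \<in> {of_int n * l..<of_int n * l + l2} \<Longrightarrow> right_lim (deriv p) x = p' x"
      "left_lim (deriv p) (of_int n * l + l2) = p' (of_int n * l + l2)"
      using Ck_on_2_solves[OF _ _ N(2), of "of_int n * l" "of_int n * l + l2" p]
        C2 eq interior_not_interface patchwise_P2
      unfolding all_patches_closure_iff P2_def by metis
    have "q x / \<sigma> = p' x" if "x \<in> {of_int n * l..of_int n * l + l2}" for x
    proof (cases "x = of_int n * l + l2")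
      case True
      then have "x \<in> S2 l1 l2"
        by (auto simp: S2_def)
      moreover have "x \<in> {of_int (n + 1) * l - l1..<of_int (n + 1) * l}"
        using l1 True by (auto simp: algebra_simps)
      ultimately have "q x = \<sigma> * left_lim (deriv p) x"
        using S2 q1 by metis
      then show ?thesis
        using p'(3) \<sigma> True by simp
    next
      case False
      then show ?thesis
        using that p'(2) q2[of x n] \<sigma> by simp
    qed
    then show ?thesis
      using solves_transform[OF p'(1)] unfolding P2_def by simp
  qed
  have "continuous_on UNIV q"
  proof (rule continuous_on_patches)
    show "continuous_on (P1 n) q" for n
      using solves_continuous(2)[OF 1] .
    have "continuous_on (P2 n) (\<lambda>x. \<sigma> * (q x / \<sigma>))" for n
      by (intro continuous_on_mult_left solves_continuous(2)[OF 2])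
    then show "continuous_on (P2 n) q" for n
      using \<sigma> by simp
  qed
  with 1 2 show thesis
    using that by blast
qed

end

context two_patches
begin

section \<open>Nonexistence of positive bounded solutions\<close>

lemma solves_at_interior:
  assumes 1: "\<And>n. solves N1 p q (P1 n)" and 2: "\<And>n. solves N2 p (\<lambda>x. q x / \<sigma>) (P2 n)"
    and \<sigma>: "\<sigma> > 0" and x: "x \<notin> interfaces l1 l2"
  shows "(p has_real_derivative q x / patchwise l1 l2 1 \<sigma> x) (at x)"
    and "(q has_real_derivative - patchwise l1 l2 1 \<sigma> x * patchwise l1 l2 N1 N2 x (p x)) (at x)"
proof (atomize (full), cases rule: non_interface_cases[OF x])
  case (1 n)
  then have "at x within P1 n = at x" "x \<in> P1 n"
    by (auto simp: P1_def at_within_Icc_at)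
  then show "(p has_real_derivative q x / patchwise l1 l2 1 \<sigma> x) (at x) \<and>
      (q has_real_derivative - patchwise l1 l2 1 \<sigma> x * patchwise l1 l2 N1 N2 x (p x)) (at x)"
    using assms(1)[of n] by (auto simp: solves_def patchwise_P1[OF 1])
next
  case (2 n)
  then have *: "at x within P2 n = at x" "x \<in> P2 n"
    by (auto simp: P2_def at_within_Icc_at)
  then have "((\<lambda>x. \<sigma> * (q x / \<sigma>)) has_real_derivative \<sigma> * - N2 (p x)) (at x)"
    using assms(2)[of n] by (intro DERIV_cmult) (auto simp: solves_def)
  then show "(p has_real_derivative q x / patchwise l1 l2 1 \<sigma> x) (at x) \<and>
      (q has_real_derivative - patchwise l1 l2 1 \<sigma> x * patchwise l1 l2 N1 N2 x (p x)) (at x)"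
    using assms(2)[of n] * \<sigma> by (auto simp: solves_def patchwise_P2[OF 2])
qed

lemma periodic_of_int:
  assumes "periodic l p"
  shows "p (x + of_int n * l) = p x"
proof -
  interpret periodic_fun_simple p l
    by unfold_locales (use assms in \<open>simp add: periodic_def\<close>)
  show ?thesis
    by (rule plus_of_int)
qed

lemma periodic_pos_bounds:
  assumes per: "periodic l \<phi>" and cont: "continuous_on UNIV \<phi>" and pos: "\<And>x. \<phi> x > 0"
  obtains c C where "c > 0" "\<And>x. c \<le> \<phi> x" "\<And>x. \<phi> x \<le> C"
proof -
  have cont': "continuous_on {- l1..l2} \<phi>" and ne: "{- l1..l2} \<noteq> {}"
    using cont l1 l2 by (auto intro: continuous_on_subset)
  obtain a where a: "\<And>x. x \<in> {- l1..l2} \<Longrightarrow> \<phi> a \<le> \<phi> x"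
    using continuous_attains_inf[OF compact_Icc ne cont'] by blast
  obtain b where b: "\<And>x. x \<in> {- l1..l2} \<Longrightarrow> \<phi> x \<le> \<phi> b"
    using continuous_attains_sup[OF compact_Icc ne cont'] by blast
  have "\<phi> a \<le> \<phi> x \<and> \<phi> x \<le> \<phi> b" for x
  proof -
    obtain n where n: "x \<in> {of_int n * l - l1..of_int n * l + l2}"
    proof (cases rule: patch_index_cases[of x])
      case (1 n)
      then show ?thesis using that[of n] l2 by auto
    next
      case (2 n)
      then show ?thesis using that[of n] l1 by auto
    qed
    have "\<phi> x = \<phi> (x - of_int n * l)"
      using periodic_of_int[OF per, of "x - of_int n * l" n] by simp
    then show ?thesis
      using a[of "x - of_int n * l"] b[of "x - of_int n * l"] n by auto
  qed
  then show thesis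
    using that[of "\<phi> a" "\<phi> b"] pos by blast
qed

text \<open>A Liouville argument. Let \<open>\<theta>\<close> and \<open>q\<close> be the fluxes of \<open>\<phi>\<close> and \<open>p\<close>. The Wronskian
  \<open>W = q * \<phi> - p * \<theta>\<close> is continuous and nondecreasing because \<open>p\<close> is a subsolution of the linear
  equation solved by \<open>\<phi>\<close>, and the quotient \<open>p / \<phi>\<close> has the derivative \<open>W / (w * \<phi>\<^sup>2)\<close>. If \<open>W\<close> were
  positive somewhere, it would stay so to the right and \<open>p / \<phi>\<close> would grow linearly at \<open>+\<infinity>\<close>; if it were
  negative somewhere, the same would happen at \<open>-\<infinity>\<close>. Both contradict boundedness, so \<open>W = 0\<close> and \<open>p\<close>
  is a multiple of \<open>\<phi>\<close>; a positive multiple is excluded by the strict inequality.\<close>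

lemma bounded_solution_vanishes:
  assumes \<sigma>: "\<sigma> > 0"
    and sub: "\<And>s. s \<ge> 0 \<Longrightarrow> N1 s \<le> c1 * s" "\<And>s. s \<ge> 0 \<Longrightarrow> N2 s \<le> c2 * s"
    and strict: "(\<forall>s>0. N1 s < c1 * s) \<or> (\<forall>s>0. N2 s < c2 * s)"
    and \<phi>: "continuous_on UNIV \<phi>" "periodic l \<phi>" "\<And>x. \<phi> x > 0"
    and \<theta>: "continuous_on UNIV \<theta>" "\<And>n. solves (\<lambda>s. c1 * s) \<phi> \<theta> (P1 n)"
      "\<And>n. solves (\<lambda>s. c2 * s) \<phi> (\<lambda>x. \<theta> x / \<sigma>) (P2 n)"
    and p: "continuous_on UNIV p" "\<And>x. p x \<ge> 0" "bounded (range p)"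
    and q: "continuous_on UNIV q" "\<And>n. solves N1 p q (P1 n)"
      "\<And>n. solves N2 p (\<lambda>x. q x / \<sigma>) (P2 n)"
  shows "p x = 0"
proof -
  \<comment> \<open>\<open>w\<close> is the weight of the flux; \<open>G\<close> is the defect by which \<open>p\<close> fails to solve the linear equation.\<close>
  define w where "w = patchwise l1 l2 1 \<sigma>"
  define G where "G x = patchwise l1 l2 c1 c2 x * p x - patchwise l1 l2 N1 N2 x (p x)" for x
  define W where "W x = q x * \<phi> x - p x * \<theta> x" for x
  define z where "z x = p x / \<phi> x" for x
  have w: "w x > 0" "w x \<le> max 1 \<sigma>" for x
    using \<sigma> by (auto simp: w_def patchwise_def)
  have pw: "patchwise l1 l2 (\<lambda>s. c1 * s) (\<lambda>s. c2 * s) x s = patchwise l1 l2 c1 c2 x * s" for x s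
    by (simp add: patchwise_def)
  have G_nonneg: "G x \<ge> 0" for x
    using sub p(2) by (simp add: G_def patchwise_def)
  have nz: "\<phi> x \<noteq> 0" "w x \<noteq> 0" for x
    using \<phi>(3)[of x] w(1)[of x] by auto

  have W_cont: "continuous_on UNIV W"
    unfolding W_def by (intro continuous_intros p q \<phi> \<theta>)
  have z_cont: "continuous_on UNIV z"
    unfolding z_def using nz by (intro continuous_intros p \<phi>) auto
  have dW: "(W has_real_derivative w x * \<phi> x * G x) (at x)"
    and dz: "(z has_real_derivative W x / (w x * (\<phi> x)\<^sup>2)) (at x)" if x: "x \<notin> interfaces l1 l2" for x
  proof -
    note d = solves_at_interior[OF q(2,3) \<sigma> x, folded w_def] solves_at_interior[OF \<theta>(2,3) \<sigma> x, folded w_def, unfolded pw]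
    show "(W has_real_derivative w x * \<phi> x * G x) (at x)"
      unfolding W_def using nz[of x]
      by (auto intro!: derivative_eq_intros d simp: G_def field_simps)
    show "(z has_real_derivative W x / (w x * (\<phi> x)\<^sup>2)) (at x)"
      unfolding z_def W_def using nz[of x]
      by (auto intro!: derivative_eq_intros d simp: field_simps power2_eq_square)
  qed
  have W_mono: "W a \<le> W b" if "a \<le> b" for a b
    using growth_off_interfaces[OF that W_cont dW, of 0] w(1) \<phi>(3) G_nonneg by (simp add: less_imp_le)

  obtain c C where c: "c > 0" "\<And>x. c \<le> \<phi> x" and C: "\<And>x. \<phi> x \<le> C"
    using periodic_pos_bounds[OF \<phi>(2,1,3)] by blast
  obtain B where B: "\<And>x. \<bar>p x\<bar> \<le> B"
    using p(3) by (auto simp: bounded_real)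
  have "B \<ge> 0"
    using B[of 0] by linarith
  have z_bounds: "0 \<le> z x" "z x \<le> B / c" for x
    using p(2)[of x] \<phi>(3)[of x] B[of x] c \<open>B \<ge> 0\<close>
    by (auto simp: z_def intro!: frac_le)
  have "C > 0"
    using C[of 0] \<phi>(3)[of 0] by linarith
  have ratio: "\<bar>y\<bar> / (max 1 \<sigma> * C\<^sup>2) \<le> \<bar>y\<bar> / (w x * (\<phi> x)\<^sup>2)" for x y
    using w[of x] \<phi>(3)[of x] C[of x] \<open>C > 0\<close>
    by (intro divide_left_mono mult_mono power_mono mult_pos_pos) auto
  have W_zero: "W x0 = 0" for x0
  proof (rule ccontr)
    assume "W x0 \<noteq> 0"
    define m where "m = \<bar>W x0\<bar> / (max 1 \<sigma> * C\<^sup>2)"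
    have m: "m > 0"
      using \<open>W x0 \<noteq> 0\<close> \<open>C > 0\<close> by (simp add: m_def)
    define L where "L = (B / c + 1) / m"
    have L: "m * L > B / c" "L > 0"
      using m c(1) \<open>B \<ge> 0\<close> by (auto simp: L_def intro!: divide_pos_pos add_nonneg_pos)
    show False
    proof (cases "W x0 > 0")
      case True
      have "z (x0 + L) - z x0 \<ge> m * (x0 + L - x0)"
      proof (rule growth_off_interfaces[OF _ z_cont dz])
        fix x assume "x0 < x"
        then have "W x0 \<le> W x"
          by (intro W_mono) simp
        then show "m \<le> W x / (w x * (\<phi> x)\<^sup>2)"
          using True w(1)[of x] \<phi>(3)[of x]
          unfolding m_def by (intro order_trans[OF ratio[of "W x0" x]] divide_right_mono) auto
      qed (use L in auto)
      then show False
        using z_bounds[of x0] z_bounds[of "x0 + L"] L by simp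
    next
      case False
      have dz': "((\<lambda>x. - z x) has_real_derivative - (W x / (w x * (\<phi> x)\<^sup>2))) (at x)"
        if "x \<notin> interfaces l1 l2" for x
        by (rule DERIV_minus[OF dz[OF that]])
      have "- z x0 - - z (x0 - L) \<ge> m * (x0 - (x0 - L))"
      proof (rule growth_off_interfaces[OF _ continuous_on_minus[OF z_cont] dz'])
        fix x assume "x < x0"
        then have "W x \<le> W x0"
          by (intro W_mono) simp
        then show "m \<le> - (W x / (w x * (\<phi> x)\<^sup>2))"
          using False w(1)[of x] \<phi>(3)[of x]
          unfolding m_def minus_divide_left by (intro order_trans[OF ratio[of "W x0" x]] divide_right_mono) auto
      qed (use L in auto)
      then show False
        using z_bounds[of x0] z_bounds[of "x0 - L"] L by simp
    qed
  qed
  have z_const: "z a = z b" for a b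
  proof -
    have "z b - z a \<ge> 0 \<and> - z b - - z a \<ge> 0" if "a \<le> b" for a b
      using growth_off_interfaces[OF that z_cont dz, of 0] W_zero
        growth_off_interfaces[OF that continuous_on_minus[OF z_cont] DERIV_minus[OF dz], of 0]
      by simp
    from this[of a b] this[of b a] show ?thesis
      by (cases "a \<le> b") auto
  qed
  have G_zero: "G y = 0" if "y \<notin> interfaces l1 l2" for y
  proof -
    have "W = (\<lambda>x. 0)"
      using W_zero by auto
    then have "w y * \<phi> y * G y = 0"
      using dW[OF that] DERIV_unique[OF _ DERIV_const] by metis
    then show ?thesis
      using nz[of y] by simp
  qed
  have "\<exists>y. p y = 0"
  proof (rule ccontr)
    assume "\<nexists>y. p y = 0"
    then have p_pos: "p y > 0" for y
      using p(2)[of y] by (metis less_le)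
    have y1: "- l1 / 2 \<in> {of_int 0 * l - l1<..<of_int 0 * l}"
      and y2: "l2 / 2 \<in> {of_int 0 * l<..<of_int 0 * l + l2}"
      using l1 l2 by auto
    have "c1 * p (- l1 / 2) = N1 (p (- l1 / 2))" "c2 * p (l2 / 2) = N2 (p (l2 / 2))"
      using G_zero[OF interior_not_interface[OF disjI1[OF y1]]] G_zero[OF interior_not_interface[OF disjI2[OF y2]]]
      unfolding G_def patchwise_P1[OF y1] patchwise_P2[OF y2] by simp_all
    then show False
      using strict p_pos by (metis less_irrefl)
  qed
  then obtain y where "p y = 0" ..
  then show ?thesis
    using z_const[of x y] nz[of x] by (simp add: z_def)
qed

end

lemma slope_at_0:
  fixes f :: "real \<Rightarrow> real"
  assumes "f differentiable at 0" "f 0 = 0"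
  shows "((\<lambda>s. f s / s) \<longlongrightarrow> deriv f 0) (at_right 0)"
proof -
  have "(f has_real_derivative deriv f 0) (at 0)"
    using assms(1) by (simp add: DERIV_deriv_iff_real_differentiable)
  then have "((\<lambda>s. f s / s) \<longlongrightarrow> deriv f 0) (at 0)"
    using assms(2) by (simp add: DERIV_def)
  then show ?thesis
    by (rule tendsto_mono[rotated]) (simp add: at_le)
qed

text \<open>The slope \<open>f s / s\<close> is monotone and tends to \<open>f'(0)\<close> as \<open>s\<close> decreases to \<open>0\<close>. The limit could lose
  strictness, which is kept by comparing with the slope at \<open>s / 2\<close> first.\<close>

lemma below_tangent:
  fixes f :: "real \<Rightarrow> real"
  assumes f: "f differentiable at 0" "f 0 = 0" and mono: "antimono_on {0<..} (\<lambda>s. f s / s)"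
  shows "s \<ge> 0 \<Longrightarrow> f s \<le> deriv f 0 * s"
    and "strict_antimono_on {0<..} (\<lambda>s. f s / s) \<Longrightarrow> s > 0 \<Longrightarrow> f s < deriv f 0 * s"
proof -
  have le: "f s / s \<le> deriv f 0" if "s > 0" for s
  proof (rule tendsto_lowerbound[OF slope_at_0[OF f]])
    show "\<forall>\<^sub>F h in at_right 0. f s / s \<le> f h / h"
      using mono that by (intro eventually_at_rightI[of _ s]) (auto simp: monotone_on_def)
  qed simp
  show "f s \<le> deriv f 0 * s" if "s \<ge> 0"
    using le[of s] that f(2) by (cases "s = 0") (auto simp: field_simps)
  show "f s < deriv f 0 * s" if "strict_antimono_on {0<..} (\<lambda>s. f s / s)" "s > 0"
  proof -
    have "f s / s < f (s / 2) / (s / 2)"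
      using that(2) monotone_onD[OF that(1), of "s / 2" s] by simp
    also have "\<dots> \<le> deriv f 0"
      using le[of "s / 2"] that by simp
    finally show ?thesis
      using that by (simp add: field_simps)
  qed
qed

section \<open>Construction of a periodic solution\<close>

lemma solves_Ck_2:
  assumes "solves N p p' T" "continuous_on UNIV N"
  shows "Ck_on 2 p T"
  unfolding Ck_on_def
proof (intro exI[of _ "\<lambda>j::nat. if j = 0 then p else if j = 1 then p' else (\<lambda>x. - N (p x))"] conjI)
  let ?D = "\<lambda>j::nat. if j = 0 then p else if j = 1 then p' else (\<lambda>x. - N (p x))"
  show "?D 0 = p"
    by simp
  show "\<forall>j<2. \<forall>x\<in>T. (?D j has_real_derivative ?D (Suc j) x) (at x within T)"
    using assms(1) by (auto simp: solves_def less_2_cases_iff)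
  have "continuous_on T (\<lambda>x. - N (p x))"
    using solves_continuous(1)[OF assms(1)]
    by (intro continuous_intros continuous_on_compose2[OF assms(2)]) auto
  then show "continuous_on T (?D 2)"
    by simp
qed

text \<open>Cutting \<open>f\<close> off at \<open>0\<close> and \<open>M\<close> makes it globally Lipschitz and constant outside \<open>[0, M]\<close>, as
  the shooting argument requires. Solutions with values in \<open>[0, M]\<close> do not notice the change.\<close>

lemma truncation_lipschitz:
  fixes f :: "real \<Rightarrow> real"
  assumes f: "f C1_differentiable_on UNIV" and M: "M > 0"
  obtains L where "L-lipschitz_on UNIV (\<lambda>s. f (max 0 (min s M)) / d)"
proof -
  obtain f' where f': "\<And>x. (f has_real_derivative f' x) (at x)" and cont: "continuous_on UNIV f'"
    using f unfolding C1_differentiable_on_def has_real_derivative_iff_has_vector_derivative by auto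
  have "bounded (f' ` {0..M})"
    by (intro compact_imp_bounded compact_continuous_image continuous_on_subset[OF cont]) auto
  then obtain B where B: "\<And>x. x \<in> {0..M} \<Longrightarrow> norm (f' x) \<le> B"
    unfolding bounded_iff by blast
  have B0: "B \<ge> 0"
    using order_trans[OF norm_ge_zero B[of 0]] M by simp
  have lip: "\<bar>f x - f y\<bar> \<le> B * \<bar>x - y\<bar>" if "x \<in> {0..M}" "y \<in> {0..M}" for x y
    using field_differentiable_bound[of "{0..M}" f f' B x y] f' B that
    by (auto intro: has_field_derivative_at_within)
  show thesis
  proof (rule that[of "B / \<bar>d\<bar>"], rule lipschitz_onI)
    fix s t :: real
    let ?c = "\<lambda>s. max 0 (min s M)"
    have "\<bar>f (?c s) - f (?c t)\<bar> \<le> B * \<bar>?c s - ?c t\<bar>"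
      using M by (intro lip) auto
    also have "\<dots> \<le> B * \<bar>s - t\<bar>"
      using B0 by (intro mult_left_mono) auto
    finally show "dist (f (?c s) / d) (f (?c t) / d) \<le> B / \<bar>d\<bar> * dist s t"
      by (simp add: dist_real_def abs_divide divide_right_mono flip: diff_divide_distrib)
  qed (use B0 in auto)
qed

context two_patches
begin

lemma centre_distance:
  "x \<in> P1 n \<Longrightarrow> \<bar>x - of_int n * l + l1 / 2\<bar> \<le> l1 / 2"
  "x \<in> P2 n \<Longrightarrow> \<bar>x - of_int n * l - l2 / 2\<bar> \<le> l2 / 2"
  unfolding P1_def P2_def atLeastAtMost_iff abs_le_iff by linarith+

text \<open>\<open>A\<close> and \<open>B\<close> are profiles in a coordinate centred in the patch. After subtraction of the multiple
  of \<open>l\<close>, the coordinate \<open>y\<close> runs through \<open>[- l1, l2)\<close>, a patch of type 1 followed by one of type 2.\<close>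

definition glue :: "(real \<Rightarrow> real) \<Rightarrow> (real \<Rightarrow> real) \<Rightarrow> real \<Rightarrow> real" where
  "glue A B x = (let y = x - of_int \<lfloor>(x + l1) / l\<rfloor> * l in if y < 0 then A (y + l1 / 2) else B (y - l2 / 2))"

lemma glue_eq:
  assumes "x \<in> {of_int n * l - l1..<of_int n * l + l2}"
  shows "glue A B x = (if x < of_int n * l then A (x - of_int n * l + l1 / 2) else B (x - of_int n * l - l2 / 2))"
proof -
  have "\<lfloor>(x + l1) / l\<rfloor> = n"
    using assms l1 l2 by (intro floor_unique) (auto simp: field_simps)
  then show ?thesis
    by (simp add: glue_def)
qed

lemma glue_P1:
  assumes "A (l1 / 2) = B (- l2 / 2)" "x \<in> P1 n"
  shows "glue A B x = A (x - of_int n * l + l1 / 2)"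
  using assms l1 l2 glue_eq[of x n A B] by (auto simp: P1_def)

lemma glue_P2:
  assumes "A (- l1 / 2) = B (l2 / 2)" "x \<in> P2 n"
  shows "glue A B x = B (x - of_int n * l - l2 / 2)"
proof (cases "x = of_int n * l + l2")
  case True
  then have "x - of_int (n + 1) * l = - l1"
    by (simp add: algebra_simps)
  then show ?thesis
    using assms l1 l2 glue_eq[of x "n + 1" A B] True by auto
next
  case False
  then show ?thesis
    using assms l1 l2 glue_eq[of x n A B] by (auto simp: P2_def)
qed

lemma glue_periodic: "periodic l (glue A B)"
proof -
  have "(x + l + l1) / l = (x + l1) / l + 1" for x
    using l1 l2 by (simp add: field_simps)
  then have "\<lfloor>(x + l + l1) / l\<rfloor> = \<lfloor>(x + l1) / l\<rfloor> + 1" for x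
    by simp
  then show ?thesis
    unfolding periodic_def glue_def by (simp only:) (simp add: algebra_simps)
qed

text \<open>Evenness of the profiles about the patch centres turns the matching at one interface into the
  matching at all of them: an interface of the other kind is its mirror image, with both slopes
  reversed.\<close>

lemma glue_stationary:
  assumes d: "d1 > 0" "d2 > 0"
    and h: "continuous_on UNIV h1" "continuous_on UNIV h2"
    and A: "solves h1 A A' UNIV" "\<And>t. A (- t) = A t" "\<And>t. A' (- t) = - A' t"
    and B: "solves h2 B B' UNIV" "\<And>t. B (- t) = B t" "\<And>t. B' (- t) = - B' t"
    and match: "A (l1 / 2) = B (l2 / 2)" "A' (l1 / 2) = - \<sigma> * B' (l2 / 2)"
    and fA: "\<And>t. \<bar>t\<bar> \<le> l1 / 2 \<Longrightarrow> h1 (A t) = f1 (A t) / d1"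
    and fB: "\<And>t. \<bar>t\<bar> \<le> l2 / 2 \<Longrightarrow> h2 (B t) = f2 (B t) / d2"
  shows "stationary_solution l1 l2 d1 d2 \<sigma> f1 f2 (glue A B)"
proof -
  let ?p = "glue A B"
  define pA where "pA n x = A' (x - of_int n * l + l1 / 2)" for n :: int and x
  define pB where "pB n x = B' (x - of_int n * l - l2 / 2)" for n :: int and x
  have p1: "?p x = A (x - of_int n * l + l1 / 2)" if "x \<in> P1 n" for x n
    using glue_P1[OF _ that, of A B] match B(2)[of "l2 / 2"] by simp
  have p2: "?p x = B (x - of_int n * l - l2 / 2)" if "x \<in> P2 n" for x n
    using glue_P2[OF _ that, of A B] match A(2)[of "l1 / 2"] by simp
  have s1: "solves h1 ?p (pA n) (P1 n)" for n
  proof (rule solves_transform)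
    show "solves h1 (\<lambda>t. A (l1 / 2 - of_int n * l + t)) (\<lambda>t. A' (l1 / 2 - of_int n * l + t)) (P1 n)"
      by (rule solves_subset[OF solves_shift[OF A(1)]]) simp
  qed (simp_all add: p1 pA_def algebra_simps)
  have s2: "solves h2 ?p (pB n) (P2 n)" for n
  proof (rule solves_transform)
    show "solves h2 (\<lambda>t. B (- l2 / 2 - of_int n * l + t)) (\<lambda>t. B' (- l2 / 2 - of_int n * l + t)) (P2 n)"
      by (rule solves_subset[OF solves_shift[OF B(1)]]) simp
  qed (simp_all add: p2 pB_def algebra_simps)
  have ends: "of_int n * l - l1 < of_int n * l" "of_int n * l < of_int n * l + l2" for n :: int
    using l1 l2 by auto
  note D1 = solves_one_sided[OF ends(1) s1[unfolded P1_def]]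
  note D2 = solves_one_sided[OF ends(2) s2[unfolded P2_def]]
  show ?thesis
    unfolding stationary_solution_def all_patches_closure_iff
  proof (intro conjI allI ballI impI)
    show "continuous_on UNIV ?p"
      by (intro continuous_on_patches solves_continuous(1)[OF s1] solves_continuous(1)[OF s2])
    show "Ck_on 2 ?p (P1 n)" "Ck_on 2 ?p (P2 n)" for n
      using solves_Ck_2 s1 s2 h by blast+
    show "- patchwise l1 l2 d1 d2 x * deriv (deriv ?p) x - patchwise l1 l2 f1 f2 x (?p x) = 0"
      if "x \<notin> interfaces l1 l2" for x
    proof (cases rule: non_interface_cases[OF that])
      case (1 n)
      have "x \<in> P1 n"
        using 1 by (auto simp: P1_def)
      have "deriv (deriv ?p) x = - h1 (?p x)"
        by (rule D1(1)[OF 1])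
      moreover have "h1 (?p x) = f1 (?p x) / d1"
        unfolding p1[OF \<open>x \<in> P1 n\<close>] by (intro fA centre_distance \<open>x \<in> P1 n\<close>)
      ultimately show ?thesis
        using d by (simp add: patchwise_P1[OF 1])
    next
      case (2 n)
      have "x \<in> P2 n"
        using 2 by (auto simp: P2_def)
      have "deriv (deriv ?p) x = - h2 (?p x)"
        by (rule D2(1)[OF 2])
      moreover have "h2 (?p x) = f2 (?p x) / d2"
        unfolding p2[OF \<open>x \<in> P2 n\<close>] by (intro fB centre_distance \<open>x \<in> P2 n\<close>)
      ultimately show ?thesis
        using d by (simp add: patchwise_P2[OF 2])
    qed
  next
    fix x assume "x \<in> S1 l1 l2"
    then obtain n where x: "x = of_int n * l"
      by (auto simp: S1_def)
    have left: "x \<in> {of_int n * l - l1<..of_int n * l}" and right: "x \<in> {of_int n * l..<of_int n * l + l2}"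
      using x l1 l2 by auto
    show "left_lim ?p x = right_lim ?p x"
      by (simp add: D1(2)[OF left] D2(3)[OF right])
    have "left_lim (deriv ?p) x = A' (l1 / 2)" "right_lim (deriv ?p) x = B' (- (l2 / 2))"
      by (simp_all add: D1(4)[OF left] D2(5)[OF right]) (simp_all add: x pA_def pB_def)
    then show "left_lim (deriv ?p) x = \<sigma> * right_lim (deriv ?p) x"
      using match(2) B(3)[of "l2 / 2"] by simp
  next
    fix x assume "x \<in> S2 l1 l2"
    then obtain n where x: "x = of_int n * l + l2" "x = of_int (n + 1) * l - l1"
      by (auto simp: S2_def algebra_simps)
    have left: "x \<in> {of_int n * l<..of_int n * l + l2}"
      using x(1) l2 by auto
    have right: "x \<in> {of_int (n + 1) * l - l1..<of_int (n + 1) * l}"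
      unfolding x(2) using l1 by simp
    show "left_lim ?p x = right_lim ?p x"
      unfolding D2(2)[OF left] D1(3)[OF right] ..
    have "left_lim (deriv ?p) x = B' (l2 / 2)"
      unfolding D2(4)[OF left] by (simp add: pB_def x(1))
    moreover have "right_lim (deriv ?p) x = A' (- (l1 / 2))"
      unfolding D1(5)[OF right] pA_def by (simp add: x(2))
    ultimately show "\<sigma> * left_lim (deriv ?p) x = right_lim (deriv ?p) x"
      using match(2) A(3)[of "l1 / 2"] by simp
  qed
qed

text \<open>The comparison functions needed for shooting must be flat at the patch centres. They are obtained
  by adding to \<open>\<phi>\<close> its reflection about the centre of a patch: \<open>x \<mapsto> - l1 - x\<close> and \<open>x \<mapsto> l2 - x\<close> differ by
  one period, so by periodicity they are the same reflection of \<open>\<phi>\<close>, and the sum is again a positive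
  solution of the linear equation on both half-patches.\<close>

lemma periodic_solution_exists:
  assumes \<sigma>: "\<sigma> > 0" and d: "d1 > 0" "d2 > 0" and M: "M > 0"
    and f: "f1 C1_differentiable_on UNIV" "f2 C1_differentiable_on UNIV" "f1 0 = 0" "f2 0 = 0"
    and fM: "f1 M \<le> 0" "f2 M \<le> 0"
    and \<delta>: "\<delta> > 0" "\<And>s. 0 < s \<Longrightarrow> s < \<delta> \<Longrightarrow> c1 * s < f1 s / d1"
      "\<And>s. 0 < s \<Longrightarrow> s < \<delta> \<Longrightarrow> c2 * s < f2 s / d2"
    and \<phi>: "periodic l \<phi>" "\<And>x. \<phi> x > 0"
    and \<theta>: "\<And>n. solves (\<lambda>s. c1 * s) \<phi> \<theta> (P1 n)" "\<And>n. solves (\<lambda>s. c2 * s) \<phi> (\<lambda>x. \<theta> x / \<sigma>) (P2 n)"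
  obtains p where "stationary_solution l1 l2 d1 d2 \<sigma> f1 f2 p" "bounded (range p)" "\<And>x. p x > 0" "periodic l p"
proof -
  define h1 where "h1 s = f1 (max 0 (min s M)) / d1" for s
  define h2 where "h2 s = f2 (max 0 (min s M)) / d2" for s
  obtain L1 L2 where lip: "L1-lipschitz_on UNIV h1" "L2-lipschitz_on UNIV h2"
    using truncation_lipschitz[OF f(1) M] truncation_lipschitz[OF f(2) M] unfolding h1_def h2_def by metis
  define \<psi>1 where "\<psi>1 t = \<phi> (- l1 / 2 + t) + \<phi> (- l1 / 2 - t)" for t
  define \<psi>1' where "\<psi>1' t = \<theta> (- l1 / 2 + t) + - \<theta> (- l1 / 2 - t)" for t
  define \<psi>2 where "\<psi>2 t = \<phi> (0 + t) + \<phi> (l2 - t)" for t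
  define \<psi>2' where "\<psi>2' t = \<theta> (0 + t) / \<sigma> + - (\<theta> (l2 - t) / \<sigma>)" for t
  have \<psi>1: "solves (\<lambda>s. c1 * s) \<psi>1 \<psi>1' {0..l1 / 2}"
    unfolding \<psi>1_def \<psi>1'_def
    by (intro solves_linear_add solves_subset[OF solves_shift[OF \<theta>(1)[of 0]]]
        solves_subset[OF solves_reflect[OF \<theta>(1)[of 0]]]) (auto simp: P1_def)
  have \<psi>2: "solves (\<lambda>s. c2 * s) \<psi>2 \<psi>2' {0..l2 / 2}"
    unfolding \<psi>2_def \<psi>2'_def
    by (intro solves_linear_add solves_subset[OF solves_shift[OF \<theta>(2)[of 0]]]
        solves_subset[OF solves_reflect[OF \<theta>(2)[of 0]]]) (auto simp: P2_def)
  have \<phi>_shift: "\<phi> (- l + t) = \<phi> t" for t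
    using periodic_of_int[OF \<phi>(1), of t "-1"] by (simp add: algebra_simps)
  \<comment> \<open>The flux inherits the periodicity of \<open>\<phi>\<close>: on the closed patch of type 2 both sides are the one-sided derivative of \<open>\<phi>\<close> at \<open>l2\<close>, up to the factor \<open>\<sigma>\<close>.\<close>
  have \<theta>_shift: "\<theta> (- l1) = \<theta> l2"
  proof -
    have "solves (\<lambda>s. c2 * s) \<phi> (\<lambda>t. \<theta> (- l + t) / \<sigma>) {0..l2}"
      using solves_subset[OF solves_shift[OF \<theta>(2)[of "-1"], of "- l"], of "{0..l2}"]
      unfolding \<phi>_shift by (simp add: P2_def subset_iff)
    from bspec[OF this[unfolded solves_def], of l2] l2
    have "(\<phi> has_vector_derivative \<theta> (- l1) / \<sigma>) (at l2 within {0..l2})"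
      by (simp add: has_real_derivative_iff_has_vector_derivative)
    moreover have "(\<phi> has_vector_derivative \<theta> l2 / \<sigma>) (at l2 within {0..l2})"
      using \<theta>(2)[of 0] l2 by (simp add: solves_def P2_def has_real_derivative_iff_has_vector_derivative)
    ultimately have "\<theta> (- l1) / \<sigma> = \<theta> l2 / \<sigma>"
      using l2 by (intro vector_derivative_unique_within_closed_interval[of 0 l2 l2 \<phi>]) auto
    then show ?thesis
      using \<sigma> by simp
  qed
  have null: "h1 s = 0" "h2 s = 0" if "s \<le> 0" for s
    using that f M by (simp_all add: h1_def h2_def)
  have const: "h1 s = f1 M / d1" "h2 s = f2 M / d2" if "s \<ge> M" for s
    using that M by (simp_all add: h1_def h2_def)
  have sign: "f1 M / d1 \<le> 0" "f2 M / d2 \<le> 0"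
    using fM d by (simp_all add: divide_nonpos_pos)
  have super: "c1 * s < h1 s" "c2 * s < h2 s" if "0 < s" "s < min \<delta> M" for s
    using that \<delta> by (simp_all add: h1_def h2_def)
  have pos: "l1 / 2 > 0" "l2 / 2 > 0" "min \<delta> M > 0"
    using l1 l2 \<delta> M by simp_all
  have \<psi>_pos: "\<psi>1 t > 0" "\<psi>2 t > 0" for t
    using \<phi>(2) by (simp_all add: \<psi>1_def \<psi>2_def add_pos_pos)
  have \<psi>_centre: "\<psi>1' 0 = 0" "\<psi>2' (l2 / 2) = 0"
    by (simp_all add: \<psi>1'_def \<psi>2'_def)
  have \<psi>_match: "\<psi>1 (l1 / 2) = \<psi>2 0" "\<psi>1' (l1 / 2) = \<sigma> * \<psi>2' 0"
    using \<phi>_shift[of l2] \<theta>_shift \<sigma> by (simp_all add: \<psi>1_def \<psi>2_def \<psi>1'_def \<psi>2'_def algebra_simps)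
  obtain A A' B B' where A: "solves h1 A A' UNIV" and B: "solves h2 B B' UNIV"
    and even: "\<And>t. A (- t) = A t" "\<And>t. A' (- t) = - A' t" "\<And>t. B (- t) = B t" "\<And>t. B' (- t) = - B' t"
    and match: "A (l1 / 2) = B (l2 / 2)" "A' (l1 / 2) = - \<sigma> * B' (l2 / 2)"
    and range: "\<And>t. \<bar>t\<bar> \<le> l1 / 2 \<Longrightarrow> 0 < A t \<and> A t \<le> M" "\<And>t. \<bar>t\<bar> \<le> l2 / 2 \<Longrightarrow> 0 < B t \<and> B t \<le> M"
    by (rule even_profiles_exist[OF lip null const sign M pos(1,2) \<sigma> pos(3) super
          \<psi>1 \<psi>_pos(1) \<psi>_centre(1) \<psi>2 \<psi>_pos(2) \<psi>_centre(2) \<psi>_match]) blast+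
  have p_range: "0 < glue A B x \<and> glue A B x \<le> M" for x
  proof (cases rule: patch_index_cases[of x])
    case (1 n)
    then have "x \<in> P1 n" "glue A B x = A (x - of_int n * l + l1 / 2)"
      using l2 glue_eq[of x n A B] by (auto simp: P1_def)
    then show ?thesis
      using range(1)[OF centre_distance(1)] by simp
  next
    case (2 n)
    then have "x \<in> P2 n" "glue A B x = B (x - of_int n * l - l2 / 2)"
      using l1 glue_eq[of x n A B] by (auto simp: P2_def)
    then show ?thesis
      using range(2)[OF centre_distance(2)] by simp
  qed
  show thesis
  proof (rule that)
    show "stationary_solution l1 l2 d1 d2 \<sigma> f1 f2 (glue A B)"
    proof (rule glue_stationary[OF d _ _ A even(1,2) B even(3,4) match])
      show "h1 (A t) = f1 (A t) / d1" if "\<bar>t\<bar> \<le> l1 / 2" for t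
        using range(1)[OF that] by (simp add: h1_def)
      show "h2 (B t) = f2 (B t) / d2" if "\<bar>t\<bar> \<le> l2 / 2" for t
        using range(2)[OF that] by (simp add: h2_def)
    qed (use lip lipschitz_on_continuous_on in blast)+
    show "bounded (range (glue A B))"
      using p_range by (intro boundedI[of _ M]) (auto simp: abs_of_pos)
    show "glue A B x > 0" for x
      using p_range by blast
    show "periodic l (glue A B)"
      by (rule glue_periodic)
  qed
qed

end

section \<open>The sign of the principal eigenvalue decides\<close>

lemma C1_imp_differentiable:
  fixes f :: "real \<Rightarrow> real"
  assumes "f C1_differentiable_on UNIV"
  shows "f differentiable at x" "continuous_on UNIV f"
  using assms by (auto simp: C1_differentiable_on_eq differentiable_imp_continuous_on
      differentiable_on_def intro: differentiable_at_imp_differentiable_on)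

lemma zero_stationary:
  assumes "f1 0 = 0" "f2 0 = 0"
  shows "stationary_solution l1 l2 d1 d2 \<sigma> f1 f2 (\<lambda>x. 0)"
proof -
  have "left_lim (\<lambda>x. 0) x = 0" "right_lim (\<lambda>x. 0) x = 0" for x
    unfolding left_lim_def right_lim_def by (auto intro!: tendsto_Lim)
  moreover have "Ck_on 2 (\<lambda>x. 0) T" for T
    unfolding Ck_on_def by (intro exI[of _ "\<lambda>_ _. 0"]) auto
  ultimately show ?thesis
    using assms by (simp add: stationary_solution_def patchwise_def)
qed

theorem theorem2p3:
  fixes l1 l2 d1 d2 \<sigma> lam1 :: real and f1 f2 :: "real \<Rightarrow> real"
  assumes "l1 > 0" and "l2 > 0" and "d1 > 0" and "d2 > 0" and "\<sigma> > 0"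
    and "f1 C1_differentiable_on UNIV" and "f2 C1_differentiable_on UNIV"
    and "f1 0 = 0" and "f2 0 = 0"
    and "\<exists>K1>0. \<forall>s\<ge>K1. f1 s \<le> 0" and "\<exists>K2>0. \<forall>s\<ge>K2. f2 s \<le> 0"
    and "principal_eigenvalue l1 l2 d1 d2 \<sigma> f1 f2 lam1"
  shows "(lam1 < 0 \<longrightarrow>
            (\<exists>p. stationary_solution l1 l2 d1 d2 \<sigma> f1 f2 p \<and> bounded (range p) \<and>
                 (\<forall>x. p x > 0) \<and> periodic (l1 + l2) p)) \<and>
         (lam1 \<ge> 0 \<and>
          antimono_on {0<..} (\<lambda>s. f1 s / s) \<and> antimono_on {0<..} (\<lambda>s. f2 s / s) \<and>
          (strict_antimono_on {0<..} (\<lambda>s. f1 s / s) \<or>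
           strict_antimono_on {0<..} (\<lambda>s. f2 s / s)) \<longrightarrow>
            (\<forall>p. stationary_solution l1 l2 d1 d2 \<sigma> f1 f2 p \<and> (\<forall>x. p x \<ge> 0) \<and> bounded (range p)
                 \<longleftrightarrow> p = (\<lambda>x. 0)))"
proof -
  note pos = assms(1-5) and C1 = assms(6,7) and f0 = assms(8,9)
  interpret two_patches l1 l2
    using assms by unfold_locales
  obtain \<phi> where "principal_eigenfunction l1 l2 d1 d2 \<sigma> f1 f2 lam1 \<phi>"
    using assms unfolding principal_eigenvalue_def by blast
  then have \<phi>: "continuous_on UNIV \<phi>" "periodic l \<phi>" "\<And>x. \<phi> x > 0"
    and C2: "\<forall>I\<in>patches l1 l2. Ck_on 2 \<phi> (closure I)"
    and eigen: "\<And>x. x \<notin> interfaces l1 l2 \<Longrightarrow> - patchwise l1 l2 d1 d2 x * deriv (deriv \<phi>) x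
          - deriv (patchwise l1 l2 f1 f2 x) 0 * \<phi> x = lam1 * \<phi> x"
    and jump: "\<And>x. x \<in> S1 l1 l2 \<Longrightarrow> left_lim (deriv \<phi>) x = \<sigma> * right_lim (deriv \<phi>) x"
      "\<And>x. x \<in> S2 l1 l2 \<Longrightarrow> \<sigma> * left_lim (deriv \<phi>) x = right_lim (deriv \<phi>) x"
    unfolding principal_eigenfunction_def Cinf_on_def by blast+
  define c1 where "c1 = (deriv f1 0 + lam1) / d1"
  define c2 where "c2 = (deriv f2 0 + lam1) / d2"
  have \<phi>'': "deriv (deriv \<phi>) x = - patchwise l1 l2 (\<lambda>s. c1 * s) (\<lambda>s. c2 * s) x (\<phi> x)"
    if x: "x \<notin> interfaces l1 l2" for x
    using eigen[OF x] pos(3,4) unfolding patchwise_def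
    by (cases "x \<in> \<Union> (patches1 l1 l2)"; simp only: if_True if_False) (simp_all add: c1_def c2_def field_simps)
  obtain \<theta> where \<theta>: "continuous_on UNIV \<theta>" "\<And>n. solves (\<lambda>s. c1 * s) \<phi> \<theta> (P1 n)"
    "\<And>n. solves (\<lambda>s. c2 * s) \<phi> (\<lambda>x. \<theta> x / \<sigma>) (P2 n)"
    by (rule flux_exists[OF pos(5) _ _ C2 \<phi>'' jump]) (auto intro!: continuous_intros)

  have "\<exists>p. stationary_solution l1 l2 d1 d2 \<sigma> f1 f2 p \<and> bounded (range p) \<and> (\<forall>x. p x > 0) \<and> periodic l p"
    if neg: "lam1 < 0"
  proof -
    obtain K1 K2 where K: "K1 > 0" "\<And>s. s \<ge> K1 \<Longrightarrow> f1 s \<le> 0" "\<And>s. s \<ge> K2 \<Longrightarrow> f2 s \<le> 0"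
      using assms(10,11) by blast
    have near: "\<exists>\<delta>>0. \<forall>s. 0 < s \<and> s < \<delta> \<longrightarrow> (deriv f 0 + lam1) / d * s < f s / d"
      if "f C1_differentiable_on UNIV" "f 0 = 0" "d > 0" for f :: "real \<Rightarrow> real" and d
    proof -
      have "\<forall>\<^sub>F s in at_right 0. deriv f 0 + lam1 < f s / s"
        using slope_at_0[OF C1_imp_differentiable(1)[OF that(1)] that(2)] neg by (intro order_tendstoD(1)) auto
      then obtain \<delta> where "\<delta> > 0" "\<And>s. 0 < s \<Longrightarrow> s < \<delta> \<Longrightarrow> deriv f 0 + lam1 < f s / s"
        unfolding eventually_at_right_field by blast
      then have "(deriv f 0 + lam1) * s / d < f s / d" if "0 < s" "s < \<delta>" for s
        using that \<open>d > 0\<close> by (intro divide_strict_right_mono) (auto simp: pos_less_divide_eq)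
      then show ?thesis
        using \<open>\<delta> > 0\<close> by auto
    qed
    obtain \<delta>1 \<delta>2 where \<delta>: "\<delta>1 > 0" "\<delta>2 > 0" "\<And>s. 0 < s \<Longrightarrow> s < \<delta>1 \<Longrightarrow> c1 * s < f1 s / d1"
      "\<And>s. 0 < s \<Longrightarrow> s < \<delta>2 \<Longrightarrow> c2 * s < f2 s / d2"
      using near[OF C1(1) f0(1) pos(3)] near[OF C1(2) f0(2) pos(4)] unfolding c1_def c2_def by blast
    have M: "max K1 K2 > 0" "f1 (max K1 K2) \<le> 0" "f2 (max K1 K2) \<le> 0" and "min \<delta>1 \<delta>2 > 0"
      using K \<delta> by auto
    then obtain p where "stationary_solution l1 l2 d1 d2 \<sigma> f1 f2 p" "bounded (range p)"
      "\<And>x. p x > 0" "periodic l p"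
      using periodic_solution_exists[OF pos(5,3,4) M(1) C1 f0 M(2,3) _ _ _ \<phi>(2,3) \<theta>(2,3), of "min \<delta>1 \<delta>2"] \<delta>(3,4)
      by auto
    then show ?thesis
      by blast
  qed
  moreover have "(stationary_solution l1 l2 d1 d2 \<sigma> f1 f2 p \<and> (\<forall>x. p x \<ge> 0) \<and> bounded (range p)) \<longleftrightarrow> p = (\<lambda>x. 0)"
    if nonneg: "lam1 \<ge> 0" and mono: "antimono_on {0<..} (\<lambda>s. f1 s / s)" "antimono_on {0<..} (\<lambda>s. f2 s / s)"
      and strict: "strict_antimono_on {0<..} (\<lambda>s. f1 s / s) \<or> strict_antimono_on {0<..} (\<lambda>s. f2 s / s)" for p
  proof
    assume p: "stationary_solution l1 l2 d1 d2 \<sigma> f1 f2 p \<and> (\<forall>x. p x \<ge> 0) \<and> bounded (range p)"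
    then have p_cont: "continuous_on UNIV p" and p_C2: "\<forall>I\<in>patches l1 l2. Ck_on 2 p (closure I)"
      and eq: "\<And>x. x \<notin> interfaces l1 l2 \<Longrightarrow>
        - patchwise l1 l2 d1 d2 x * deriv (deriv p) x - patchwise l1 l2 f1 f2 x (p x) = 0"
      and p_jump: "\<And>x. x \<in> S1 l1 l2 \<Longrightarrow> left_lim (deriv p) x = \<sigma> * right_lim (deriv p) x"
        "\<And>x. x \<in> S2 l1 l2 \<Longrightarrow> \<sigma> * left_lim (deriv p) x = right_lim (deriv p) x"
      unfolding stationary_solution_def by blast+
    have p'': "deriv (deriv p) x = - patchwise l1 l2 (\<lambda>s. f1 s / d1) (\<lambda>s. f2 s / d2) x (p x)"
      if x: "x \<notin> interfaces l1 l2" for x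
      using eq[OF x] pos(3,4) unfolding patchwise_def
      by (cases "x \<in> \<Union> (patches1 l1 l2)"; simp only: if_True if_False) (simp_all add: field_simps)
    obtain q where q: "continuous_on UNIV q" "\<And>n. solves (\<lambda>s. f1 s / d1) p q (P1 n)"
      "\<And>n. solves (\<lambda>s. f2 s / d2) p (\<lambda>x. q x / \<sigma>) (P2 n)"
      by (rule flux_exists[OF pos(5) _ _ p_C2 p'' p_jump])
         (use pos C1_imp_differentiable(2)[OF C1(1)] C1_imp_differentiable(2)[OF C1(2)] in
           \<open>auto intro!: continuous_intros\<close>)
    have scale: "f s / d \<le> (deriv f 0 + lam1) / d * s" if "f s \<le> deriv f 0 * s" "s \<ge> 0" "d > 0"
      for f :: "real \<Rightarrow> real" and s d
    proof -
      have "f s \<le> (deriv f 0 + lam1) * s"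
        using that(1) mult_nonneg_nonneg[OF nonneg that(2)] by (simp add: algebra_simps)
      then show ?thesis
        using that(3) by (simp add: field_simps)
    qed
    have scale_strict: "f s / d < (deriv f 0 + lam1) / d * s" if "f s < deriv f 0 * s" "s > 0" "d > 0"
      for f :: "real \<Rightarrow> real" and s d
    proof -
      have "f s < (deriv f 0 + lam1) * s"
        using that(1) mult_nonneg_nonneg[OF nonneg less_imp_le[OF that(2)]] by (simp add: algebra_simps)
      then show ?thesis
        using that(3) by (simp add: field_simps)
    qed
    note tangent1 = below_tangent[OF C1_imp_differentiable(1)[OF C1(1)] f0(1) mono(1)]
    note tangent2 = below_tangent[OF C1_imp_differentiable(1)[OF C1(2)] f0(2) mono(2)]
    have "p x = 0" for x
    proof (rule bounded_solution_vanishes[OF pos(5) _ _ _ \<phi> \<theta> p_cont _ _ q])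
      show "f1 s / d1 \<le> c1 * s" "f2 s / d2 \<le> c2 * s" if "s \<ge> 0" for s
        using scale that tangent1(1) tangent2(1) pos(3,4) unfolding c1_def c2_def by blast+
      show "(\<forall>s>0. f1 s / d1 < c1 * s) \<or> (\<forall>s>0. f2 s / d2 < c2 * s)"
        using strict scale_strict tangent1(2) tangent2(2) pos(3,4) unfolding c1_def c2_def by blast
    qed (use p in auto)
    then show "p = (\<lambda>x. 0)"
      by auto
  next
    assume "p = (\<lambda>x. 0)"
    then show "stationary_solution l1 l2 d1 d2 \<sigma> f1 f2 p \<and> (\<forall>x. p x \<ge> 0) \<and> bounded (range p)"
      using zero_stationary[of f1 f2 l1 l2 d1 d2 \<sigma>] f0 by auto
  qed
  ultimately show ?thesis
    by blast
qed

end
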